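(* Let $\alpha>0$, $\gamma>0$, $\sigma>0$, $T>0$, $x\geqslant 0$, and let $x(t)=\frac{\alpha}{\gamma}+\left(x-\frac{\alpha}{\gamma}\right)e^{-\gamma t}$. For $\epsilon>0$ let $Y^\epsilon$ be the Ornstein-Uhlenbeck process reflected at $0$, with $Y^\epsilon_0=x$ and $$\mathrm{d}Y^{\epsilon}_{t}=(\alpha-\gamma Y^{\epsilon}_{t})\,\mathrm{d}t+\sqrt{\epsilon}\,\sigma\, \mathrm{d}B_{t}+\mathrm{d}L^{\epsilon}_{t}.$$ Let $b>x(T)$. Then $$\lim_{\epsilon\to 0}\epsilon \log\mathbb{P}_x(Y^{\epsilon}_{T}\geqslant b)=-\frac{\left[b-\left(\frac{\alpha}{\gamma}+(x-\frac{\alpha}{\gamma})e^{-\gamma T}\right)\right]^{2}}{[1-e^{-2\gamma T}]\,(\sigma^{2}/\gamma)}.$$ Moreover, the minimal cost path, i.e. the minimizer of $I^+_x$ over $S^+:=\{f\in C_{[0,T]}([0,\infty)): f(0)=x,\ f(T)\geqslant b\}$, is $$f^\star(t)=\left(C-\frac{\alpha}{\gamma}\right)e^{\gamma t}+(x-C)e^{-\gamma t}+\frac{\alpha}{\gamma},\qquad C=\frac{b-\frac{\alpha}{\gamma}+\frac{\alpha}{\gamma}e^{\gamma T}-xe^{-\gamma T}}{e^{\gamma T}-e^{-\gamma T}}.$$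
   Context: $B$ is a standard Brownian motion. $L^\epsilon$ is the minimal nondecreasing continuous process with $L^\epsilon_0=0$ such that $Y^\epsilon_t\geqslant 0$ for all $t\geqslant 0$; it satisfies $\int_{[0,t]}\mathbf{1}_{\{Y^\epsilon_s>0\}}\,\mathrm{d}L^\epsilon_s=0$ for every $t>0$. The reflected equation has a unique strong solution. $\mathbb{P}_x$ denotes probability when the process starts in $x$. $C_{[0,T]}([0,\infty))$ is the space of continuous functions $[0,T]\to[0,\infty)$ with the uniform norm. $H_x:=\{f:[0,T]\to\mathbb{R}: f(t)=x+\int_0^t\phi(s)\,\mathrm{d}s,\ \phi\in L_2([0,T])\}$ and $H_x^+$ is the set of nonnegative functions in $H_x$. The functional $I_x^+$ on $C_{[0,T]}([0,\infty))$ is $$I_x^+(h)=\frac{1}{2\sigma^2}\int_0^T\left(h'(t)-\alpha+\gamma h(t)\right)^2\mathrm{d}t\ \text{ if } h\in H_x^+,\qquad I_x^+(h)=\infty\ \text{ otherwise}$$ (it is the rate function of the sample-path large deviations principle for $Y^\epsilon$). *)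

theory Defs
  imports "HOL-Probability.Probability"
begin

locale standard_brownian_motion = prob_space M for M :: "'a measure" +
  fixes B :: "real \<Rightarrow> 'a \<Rightarrow> real"
  assumes random_variable_B: "\<And>t. 0 \<le> t \<Longrightarrow> random_variable borel (B t)"
    and B_zero: "AE \<omega> in M. B 0 \<omega> = 0"
    and normal_increments:
      "\<And>s t. 0 \<le> s \<Longrightarrow> s < t \<Longrightarrow>
        distributed M lborel (\<lambda>\<omega>. B t \<omega> - B s \<omega>) (normal_density 0 (sqrt (t - s)))"
    and independent_increments:
      "\<And>(\<tau> :: nat \<Rightarrow> real) n. 0 \<le> \<tau> 0 \<Longrightarrow> mono_on {..n} \<tau> \<Longrightarrow>
        indep_vars (\<lambda>_. borel) (\<lambda>i \<omega>. B (\<tau> (Suc i)) \<omega> - B (\<tau> i) \<omega>) {..<n}"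
    and continuous_paths: "AE \<omega> in M. continuous_on {0..} (\<lambda>t. B t \<omega>)"

(* The noise is additive, so the equation has a meaning path by path.  For a fixed path w of the
   noise term, y is a nonnegative solution of dy = (\<alpha> - \<gamma> y) dt + dw + dl, y(0) = x + w(0), pushed
   upwards by the nondecreasing continuous path l with l(0) = 0. *)
definition ou_pushed_path ::
    "real \<Rightarrow> real \<Rightarrow> real \<Rightarrow> (real \<Rightarrow> real) \<Rightarrow> (real \<Rightarrow> real) \<Rightarrow> (real \<Rightarrow> real) \<Rightarrow> bool" where
  "ou_pushed_path \<alpha> \<gamma> x w y l \<longleftrightarrow>
     continuous_on {0..} y \<and> continuous_on {0..} l \<and> mono_on {0..} l \<and> l 0 = 0 \<and>
     (\<forall>t\<ge>0. 0 \<le> y t) \<and>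
     (\<forall>t\<ge>0. y t = x + (LINT s:{0..t}|lborel. \<alpha> - \<gamma> * y s) + w t + l t)"

(* l is the minimal pushing path.  The last conjunct is the property that l increases only while
   y = 0, as an integral against the Stieltjes measure dl; l is extended by l(0) = 0 to the
   negative half-line because interval_measure expects a function on the whole line. *)
definition reflected_ou_path ::
    "real \<Rightarrow> real \<Rightarrow> real \<Rightarrow> (real \<Rightarrow> real) \<Rightarrow> (real \<Rightarrow> real) \<Rightarrow> (real \<Rightarrow> real) \<Rightarrow> bool" where
  "reflected_ou_path \<alpha> \<gamma> x w y l \<longleftrightarrow>
     ou_pushed_path \<alpha> \<gamma> x w y l \<and>
     (\<forall>y' l'. ou_pushed_path \<alpha> \<gamma> x w y' l' \<longrightarrow> (\<forall>t\<ge>0. l t \<le> l' t)) \<and>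
     (\<forall>t>0. (\<integral>\<^sup>+ s\<in>{0..t}. indicator {s. 0 < y s} s \<partial>interval_measure (\<lambda>s. l (max 0 s))) = 0)"

(* Y is the Ornstein-Uhlenbeck process reflected at 0, started in x, with drift \<alpha> - \<gamma> Y and
   constant diffusion coefficient \<eta>, driven by B; L is its regulator at 0.
   The path equation has at most one solution, so adaptedness to the (augmented) filtration of B
   need not be required separately. *)
definition reflected_ou_process ::
    "'a measure \<Rightarrow> (real \<Rightarrow> 'a \<Rightarrow> real) \<Rightarrow> real \<Rightarrow> real \<Rightarrow> real \<Rightarrow> real \<Rightarrow>
      (real \<Rightarrow> 'a \<Rightarrow> real) \<Rightarrow> (real \<Rightarrow> 'a \<Rightarrow> real) \<Rightarrow> bool" where
  "reflected_ou_process M B \<alpha> \<gamma> \<eta> x Y L \<longleftrightarrow>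
     (\<forall>t\<ge>0. Y t \<in> borel_measurable M \<and> L t \<in> borel_measurable M) \<and>
     (AE \<omega> in M. reflected_ou_path \<alpha> \<gamma> x (\<lambda>t. \<eta> * B t \<omega>) (\<lambda>t. Y t \<omega>) (\<lambda>t. L t \<omega>))"

(* Functions on [0,T] are represented extensionally, so that equality of functions is equality
   on [0,T]. *)
definition nonneg_paths :: "real \<Rightarrow> (real \<Rightarrow> real) set" where
  "nonneg_paths T = {f \<in> {0..T} \<rightarrow>\<^sub>E {0..}. continuous_on {0..T} f}"

definition L2_on :: "real \<Rightarrow> (real \<Rightarrow> real) set" where
  "L2_on T = {\<phi>. set_borel_measurable lborel {0..T} \<phi> \<and>
                  set_integrable lborel {0..T} (\<lambda>t. (\<phi> t)\<^sup>2)}"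

definition H :: "real \<Rightarrow> real \<Rightarrow> (real \<Rightarrow> real) set" where
  "H T x = {f \<in> extensional {0..T}.
     \<exists>\<phi>\<in>L2_on T. \<forall>t\<in>{0..T}. f t = x + (LINT s:{0..t}|lborel. \<phi> s)}"

definition H_plus :: "real \<Rightarrow> real \<Rightarrow> (real \<Rightarrow> real) set" where
  "H_plus T x = {f \<in> H T x. \<forall>t\<in>{0..T}. 0 \<le> f t}"

(* A function in H is differentiable almost everywhere on [0,T]; the exceptional null set, which
   may be taken to contain the end points, does not affect the integral. *)
definition I_plus :: "real \<Rightarrow> real \<Rightarrow> real \<Rightarrow> real \<Rightarrow> real \<Rightarrow> (real \<Rightarrow> real) \<Rightarrow> ennreal" where
  "I_plus \<alpha> \<gamma> \<sigma> T x h =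
     (if h \<in> H_plus T x
      then ennreal (1 / (2 * \<sigma>\<^sup>2)) *
           (\<integral>\<^sup>+ t\<in>{0..T}. ennreal ((deriv h t - \<alpha> + \<gamma> * h t)\<^sup>2) \<partial>lborel)
      else \<infinity>)"

definition S_plus :: "real \<Rightarrow> real \<Rightarrow> real \<Rightarrow> (real \<Rightarrow> real) set" where
  "S_plus T x b = {f \<in> nonneg_paths T. f 0 = x \<and> b \<le> f T}"

definition minimizers :: "('b \<Rightarrow> ennreal) \<Rightarrow> 'b set \<Rightarrow> 'b set" where
  "minimizers I S = {f \<in> S. \<forall>g\<in>S. I f \<le> I g}"

definition ou_mean :: "real \<Rightarrow> real \<Rightarrow> real \<Rightarrow> real \<Rightarrow> real" where
  "ou_mean \<alpha> \<gamma> x t = \<alpha> / \<gamma> + (x - \<alpha> / \<gamma>) * exp (- \<gamma> * t)"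

definition C_const :: "real \<Rightarrow> real \<Rightarrow> real \<Rightarrow> real \<Rightarrow> real \<Rightarrow> real" where
  "C_const \<alpha> \<gamma> T x b =
     (b - \<alpha> / \<gamma> + \<alpha> / \<gamma> * exp (\<gamma> * T) - x * exp (- \<gamma> * T)) / (exp (\<gamma> * T) - exp (- \<gamma> * T))"

definition f_star :: "real \<Rightarrow> real \<Rightarrow> real \<Rightarrow> real \<Rightarrow> real \<Rightarrow> real \<Rightarrow> real" where
  "f_star \<alpha> \<gamma> T x b t =
     (C_const \<alpha> \<gamma> T x b - \<alpha> / \<gamma>) * exp (\<gamma> * t) + (x - C_const \<alpha> \<gamma> T x b) * exp (- \<gamma> * t) + \<alpha> / \<gamma>"

end

theory Submission
  imports Defs
begin

text \<open>
  For the large deviation estimate, write \<open>W(\<tau>) = \<integral>\<^sub>\<tau>\<^sup>T exp (- \<gamma> (T - s)) dB(s)\<close>. Variation of constants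
  shows that the unreflected process lies below \<open>Y\<close>, and that from the last zero \<open>\<tau>\<close> of \<open>Y\<close> on the
  regulator is constant, so \<open>Y\<^sub>T \<ge> b\<close> forces \<open>\<surd>\<epsilon> \<sigma> W(\<tau>) \<ge> b - x(T)\<close> for some \<open>\<tau>\<close>. The Riemann sums of
  \<open>W\<close>, read backwards from \<open>T\<close>, are sums of independent centred Gaussians, and an exponential maximal
  inequality shows that the supremum over \<open>\<tau>\<close> costs nothing at the exponential scale compared with
  the single Gaussian variable \<open>W(0)\<close>.

  For the minimizer, the control \<open>\<psi> = f' - \<alpha> + \<gamma> f\<close> determines \<open>f(T)\<close> through the scalar product of \<open>\<psi>\<close>
  with \<open>exp (\<gamma> t)\<close>, and the control of \<open>f\<^sup>\<star>\<close> is a positive multiple of \<open>exp (\<gamma> t)\<close>; expanding the square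
  gives \<open>\<integral>\<psi>\<^sup>2 = \<integral>\<psi>\<^sub>\<star>\<^sup>2 + \<integral>(\<psi> - \<psi>\<^sub>\<star>)\<^sup>2 + const (f(T) - b)\<close>. Lebesgue's differentiation theorem identifies
  \<open>deriv f\<close> with the density of \<open>f\<close> almost everywhere.
\<close>

section \<open>Lebesgue differentiation on the line\<close>

text \<open>\<open>integrable_ccontinuous_explicit\<close> averages over cubes having the given
  point as lower corner. On the line these are right-hand averages, hence the one-sided limit; the
  null set \<open>N\<close> contains the points where it fails.\<close>

lemma negligible_no_right_derivative:
  fixes f :: "real \<Rightarrow> real"
  assumes "\<And>a b. f integrable_on {a..b}"
  obtains N where "negligible N"
    "\<And>t. t \<notin> N \<Longrightarrow> ((\<lambda>u. integral {t..u} f / (u - t)) \<longlongrightarrow> f t) (at_right t)"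
proof -
  obtain N where N: "negligible N"
    "\<And>x e. \<lbrakk>x \<notin> N; 0 < e\<rbrakk> \<Longrightarrow> \<exists>d>0. \<forall>h. 0 < h \<and> h < d \<longrightarrow>
        norm (integral (cbox x (x + h *\<^sub>R One)) f /\<^sub>R h ^ DIM(real) - f x) < e"
    using integrable_ccontinuous_explicit[of f] assms by auto
  have "((\<lambda>u. integral {t..u} f / (u - t)) \<longlongrightarrow> f t) (at_right t)" if tN: "t \<notin> N" for t
  proof (rule tendstoI)
    fix e :: real assume "e > 0"
    then obtain d where d: "d > 0" "\<And>h. 0 < h \<Longrightarrow> h < d \<Longrightarrow> \<bar>integral {t..t + h} f / h - f t\<bar> < e"
      using N(2)[OF tN, of e] by (auto simp: divide_inverse mult.commute)
    show "\<forall>\<^sub>F u in at_right t. dist (integral {t..u} f / (u - t)) (f t) < e"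
      unfolding eventually_at_right_field
      using d(1) d(2)[of "_ - t"] by (intro exI[of _ "t + d"]) (auto simp: dist_real_def)
  qed
  with N(1) that show ?thesis by blast
qed

text \<open>Left-hand averages of \<open>f\<close> at \<open>t\<close> are right-hand averages of
  \<open>\<lambda>s. f (- s)\<close> at \<open>- t\<close>, so the exceptional set is
  \<open>N\<close> together with the mirror image of the null set \<open>N'\<close> of the reflected
  function. The restriction \<open>a < t\<close> lets \<open>u\<close> approach \<open>t\<close>
  from both sides within the range of integration.\<close>

lemma indefinite_integral_differentiable_AE:
  fixes f :: "real \<Rightarrow> real"
  assumes f: "\<And>a b. f integrable_on {a..b}"
  shows "AE t in lborel. a < t \<longrightarrow> ((\<lambda>u. integral {a..u} f) has_real_derivative f t) (at t)"
proof -
  obtain N where N: "negligible N"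
    "\<And>t. t \<notin> N \<Longrightarrow> ((\<lambda>u. integral {t..u} f / (u - t)) \<longlongrightarrow> f t) (at_right t)"
    using negligible_no_right_derivative[OF f] by metis
  have "(\<lambda>s. f (- s)) integrable_on {a..b}" for a b
    using f[of "-b" "-a"] Henstock_Kurzweil_Integration.integrable_reflect_real[where f=f and a="-b" and b="-a"] by simp
  from negligible_no_right_derivative[OF this] obtain N' where N': "negligible N'"
    "\<And>t. t \<notin> N' \<Longrightarrow> ((\<lambda>u. integral {t..u} (\<lambda>s. f (- s)) / (u - t)) \<longlongrightarrow> f (- t)) (at_right t)"
    by metis
  have neg: "negligible (N \<union> uminus ` N')"
    using N(1) N'(1)
    by (intro negligible_Un negligible_differentiable_image_negligible)
       (auto intro!: linear_imp_differentiable_on linearI)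
  have "((\<lambda>u. integral {a..u} f) has_real_derivative f t) (at t)"
    if t: "t \<notin> N \<union> uminus ` N'" "a < t" for t
  proof -
    have "((\<lambda>u. (integral {a..u} f - integral {a..t} f) / (u - t)) \<longlongrightarrow> f t) (at_right t)"
    proof (rule tendsto_cong[THEN iffD1])
      show "((\<lambda>u. integral {t..u} f / (u - t)) \<longlongrightarrow> f t) (at_right t)"
        using N(2) t by blast
      show "\<forall>\<^sub>F u in at_right t. integral {t..u} f / (u - t) = (integral {a..u} f - integral {a..t} f) / (u - t)"
        unfolding eventually_at_right_field
      proof (intro exI[of _ "t + 1"] conjI allI impI)
        fix u assume "t < u" "u < t + 1"
        then have "integral {a..t} f + integral {t..u} f = integral {a..u} f"
          using t f by (intro Henstock_Kurzweil_Integration.integral_combine) auto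
        then show "integral {t..u} f / (u - t) = (integral {a..u} f - integral {a..t} f) / (u - t)"
          by (simp add: algebra_simps)
      qed simp
    qed
    moreover have "((\<lambda>u. (integral {a..u} f - integral {a..t} f) / (u - t)) \<longlongrightarrow> f t) (at_left t)"
    proof -
      have "- t \<notin> N'" using t by force
      then have "((\<lambda>u. integral {- t..u} (\<lambda>s. f (- s)) / (u + t)) \<longlongrightarrow> f t) (at_right (- t))"
        using N'(2)[of "-t"] by simp
      then have "((\<lambda>u. integral {- t..- u} (\<lambda>s. f (- s)) / (- u + t)) \<longlongrightarrow> f t) (at_left t)"
        unfolding filterlim_at_left_to_right by simp
      then show ?thesis
      proof (rule tendsto_cong[THEN iffD1, rotated])
        show "\<forall>\<^sub>F u in at_left t. integral {- t..- u} (\<lambda>s. f (- s)) / (- u + t) = (integral {a..u} f - integral {a..t} f) / (u - t)"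
          unfolding eventually_at_left_field
        proof (intro exI[of _ a] conjI allI impI)
          fix u assume "a < u" "u < t"
          then have "integral {a..u} f + integral {u..t} f = integral {a..t} f"
            using t f by (intro Henstock_Kurzweil_Integration.integral_combine) auto
          then show "integral {- t..- u} (\<lambda>s. f (- s)) / (- u + t) = (integral {a..u} f - integral {a..t} f) / (u - t)"
            using \<open>u < t\<close> Henstock_Kurzweil_Integration.integral_reflect_real[where f=f and a=u and b=t]
            by (simp add: divide_simps) (simp add: algebra_simps flip: distrib_left)
        qed (use t in auto)
      qed
    qed
    ultimately show ?thesis
      unfolding has_field_derivative_iff by (simp add: filterlim_split_at)
  qed
  moreover have "AE t in lborel. t \<notin> N \<union> uminus ` N'"
    using neg unfolding negligible_iff_null_sets
    by (metis AE_completion_iff AE_not_in)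
  ultimately show ?thesis
    by (auto elim: eventually_mono)
qed

lemma AE_has_derivative_LINT:
  fixes \<phi> :: "real \<Rightarrow> real"
  assumes "set_integrable lborel {0..T} \<phi>"
  shows "AE t in lborel. t \<in> {0<..<T} \<longrightarrow>
    ((\<lambda>u. LINT s:{0..u}|lborel. \<phi> s) has_real_derivative \<phi> t) (at t)"
proof -
  \<comment> \<open>Integrability of \<open>\<phi>\<close> is known on \<open>{0..T}\<close> only.
    Continued by 0 it is integrable over every interval, and near an interior point the two
    indefinite integrals coincide.\<close>
  define f where "f = (\<lambda>s. indicator {0..T} s * \<phi> s)"
  have "set_integrable lborel {a..b} f" for a b
    using assms unfolding set_integrable_def f_def
    by (intro integrable_mult_indicator) auto
  then have int: "f integrable_on {a..b}" and eq: "(LINT s:{a..b}|lborel. f s) = integral {a..b} f" for a b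
    using set_borel_integral_eq_integral[of "{a..b}" f] by auto
  have "AE t in lborel. 0 < t \<longrightarrow> ((\<lambda>u. integral {0..u} f) has_real_derivative f t) (at t)"
    by (rule indefinite_integral_differentiable_AE[OF int])
  then show ?thesis
  proof (rule eventually_mono)
    fix t assume t: "0 < t \<longrightarrow> ((\<lambda>u. integral {0..u} f) has_real_derivative f t) (at t)"
    show "t \<in> {0<..<T} \<longrightarrow> ((\<lambda>u. LINT s:{0..u}|lborel. \<phi> s) has_real_derivative \<phi> t) (at t)"
    proof
      assume "t \<in> {0<..<T}"
      with t have "((\<lambda>u. integral {0..u} f) has_real_derivative \<phi> t) (at t)"
        by (simp add: f_def)
      then show "((\<lambda>u. LINT s:{0..u}|lborel. \<phi> s) has_real_derivative \<phi> t) (at t)"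
      proof (rule has_field_derivative_transform_within_open)
        show "integral {0..u} f = (LINT s:{0..u}|lborel. \<phi> s)" if "u \<in> {0<..<T}" for u
          unfolding eq[symmetric] using that
          by (intro set_lebesgue_integral_cong) (auto simp: f_def)
      qed (use \<open>t \<in> {0<..<T}\<close> in auto)
    qed
  qed
qed

section \<open>Exponentially weighted integrals and end values\<close>

text \<open>Fubini's theorem on the triangle \<open>0 \<le> u \<le> s \<le> t\<close> replaces an integration by parts with
  an absolutely continuous factor.\<close>
lemma LINT_exp_by_parts:
  fixes \<phi> :: "real \<Rightarrow> real"
  assumes \<phi>: "set_integrable lborel {0..t} \<phi>" and "0 \<le> t"
  shows "(LINT s:{0..t}|lborel. \<gamma> * exp (\<gamma> * s) * (LINT u:{0..s}|lborel. \<phi> u)) =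
    (LINT u:{0..t}|lborel. (exp (\<gamma> * t) - exp (\<gamma> * u)) * \<phi> u)"
proof -
  define p where "p = (\<lambda>u. indicator {0..t} u * \<phi> u)"
  have p: "integrable lborel p" using \<phi> by (simp add: set_integrable_def p_def)
  have [measurable]: "p \<in> borel_measurable borel" using p by auto
  define e where "e = (\<lambda>s. indicator {0..t} s * (\<gamma> * exp (\<gamma> * s)))"
  have e: "integrable lborel e"
    using borel_integrable_atLeastAtMost'[of 0 t "\<lambda>s. \<gamma> * exp (\<gamma> * s)"]
    by (simp add: set_integrable_def e_def continuous_intros)
  have [measurable]: "e \<in> borel_measurable borel" using e by auto
  define q where "q = (\<lambda>(u, s). p u * e s)"
  have q: "integrable (lborel \<Otimes>\<^sub>M lborel) q"
    using p e by (intro lborel_pair.Fubini_integrable) (auto simp: q_def abs_mult)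
  \<comment> \<open>Cutting down to the triangle only lowers the modulus of the product density
    \<open>q\<close>, so Fubini's theorem applies.\<close>
  have "integrable (lborel \<Otimes>\<^sub>M lborel) (\<lambda>(u, s). if u \<le> s then p u * e s else 0)"
    by (rule Bochner_Integration.integrable_bound[OF q]) (auto simp: q_def)
  from lborel_pair.Fubini_integral[OF this]
  have "(\<integral>s. (\<integral>u. (if u \<le> s then p u * e s else 0) \<partial>lborel) \<partial>lborel) =
    (\<integral>u. (\<integral>s. (if u \<le> s then p u * e s else 0) \<partial>lborel) \<partial>lborel)" .
  moreover have "(\<integral>u. (if u \<le> s then p u * e s else 0) \<partial>lborel) =
    indicator {0..t} s *\<^sub>R (\<gamma> * exp (\<gamma> * s) * (LINT u:{0..s}|lborel. \<phi> u))" for s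
  proof -
    have "(\<integral>u. (if u \<le> s then p u * e s else 0) \<partial>lborel) =
      (\<integral>u. e s * (indicator {0..s} u *\<^sub>R \<phi> u) \<partial>lborel)"
      by (intro Bochner_Integration.integral_cong) (auto simp: p_def e_def indicator_def)
    then show ?thesis by (simp add: e_def set_lebesgue_integral_def)
  qed
  moreover have "(\<integral>s. (if u \<le> s then p u * e s else 0) \<partial>lborel) =
    indicator {0..t} u *\<^sub>R ((exp (\<gamma> * t) - exp (\<gamma> * u)) * \<phi> u)" for u
  proof (cases "u \<in> {0..t}")
    case True
    have "(\<integral>s. \<gamma> * exp (\<gamma> * s) * indicator {u..t} s \<partial>lborel) = exp (\<gamma> * t) - exp (\<gamma> * u)"
      using True
      by (intro integral_FTC_Icc_real[where F = "\<lambda>s. exp (\<gamma> * s)"])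
         (auto intro!: derivative_eq_intros continuous_intros)
    moreover have "(\<integral>s. (if u \<le> s then p u * e s else 0) \<partial>lborel) =
      (\<integral>s. \<phi> u * (\<gamma> * exp (\<gamma> * s) * indicator {u..t} s) \<partial>lborel)"
      using True
      by (intro Bochner_Integration.integral_cong) (auto simp: p_def e_def indicator_def)
    ultimately show ?thesis using True by simp
  next
    case False
    then have "p u = 0" by (auto simp: p_def)
    with False show ?thesis by (simp cong: if_cong)
  qed
  ultimately show ?thesis
    by (simp add: set_lebesgue_integral_def)
qed

text \<open>Formally the integrand is the derivative of \<open>exp (\<gamma> * s) * f s\<close>
  minus \<open>\<alpha> * exp (\<gamma> * s)\<close>. The point is that the scalar product of a
  control with the exponential sees only the end values of the path, whatever happens in
  between.\<close>

lemma LINT_exp_weighted: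
  fixes \<phi> :: "real \<Rightarrow> real"
  assumes \<phi>: "set_integrable lborel {0..t} \<phi>" and "0 \<le> t" and "\<gamma> \<noteq> 0"
    and f: "\<And>s. s \<in> {0..t} \<Longrightarrow> f s = x + (LINT u:{0..s}|lborel. \<phi> u)"
    and cont: "continuous_on {0..t} f"
  shows "(LINT s:{0..t}|lborel. exp (\<gamma> * s) * (\<phi> s - \<alpha> + \<gamma> * f s)) =
    exp (\<gamma> * t) * f t - x - \<alpha> / \<gamma> * (exp (\<gamma> * t) - 1)"
proof -
  have exp\<phi>: "set_integrable lborel {0..t} (\<lambda>u. exp (\<gamma> * u) * \<phi> u)"
  proof (rule set_integrable_bound[where f = "\<lambda>u. exp (\<bar>\<gamma>\<bar> * t) * \<phi> u"])
    show "set_borel_measurable lborel {0..t} (\<lambda>u. exp (\<gamma> * u) * \<phi> u)"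
    proof -
      have "(\<lambda>u. indicator {0..t} u *\<^sub>R \<phi> u) \<in> borel_measurable lborel"
        using \<phi> by (auto simp: set_integrable_def)
      then have "(\<lambda>u. exp (\<gamma> * u) * (indicator {0..t} u *\<^sub>R \<phi> u)) \<in> borel_measurable lborel"
        by measurable
      then show ?thesis by (simp add: set_borel_measurable_def mult_ac)
    qed
    \<comment> \<open>The sign of \<gamma> is left open here, so the weight is dominated through its
      absolute value.\<close>
    have "\<gamma> * u \<le> \<bar>\<gamma>\<bar> * t" if "0 \<le> u" "u \<le> t" for u
      using that by (intro mult_mono) auto
    then show "AE u in lborel. u \<in> {0..t} \<longrightarrow> norm (exp (\<gamma> * u) * \<phi> u) \<le> norm (exp (\<bar>\<gamma>\<bar> * t) * \<phi> u)"
      by (auto simp: abs_mult intro!: mult_right_mono)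
  qed (use \<phi> in simp)
  have ci: "set_integrable lborel {0..t} h" if "continuous_on {0..t} h" for h :: "real \<Rightarrow> real"
    using borel_integrable_atLeastAtMost'[OF that] .
  have 1: "set_integrable lborel {0..t} (\<lambda>s. exp (\<gamma> * s) * \<gamma> * f s)"
    and 2: "set_integrable lborel {0..t} (\<lambda>s. \<alpha> * exp (\<gamma> * s))"
    and 3: "set_integrable lborel {0..t} (\<lambda>s. \<gamma> * exp (\<gamma> * s) * x)"
    by (intro ci continuous_intros cont)+
  have 4: "set_integrable lborel {0..t} (\<lambda>s. exp (\<gamma> * s) * \<gamma> * f s - \<gamma> * exp (\<gamma> * s) * x)"
    using 1 3 by simp
  have E: "(LINT s:{0..t}|lborel. \<gamma> * exp (\<gamma> * s)) = exp (\<gamma> * t) - 1"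
  proof -
    have "(\<integral>s. \<gamma> * exp (\<gamma> * s) * indicator {0..t} s \<partial>lborel) = exp (\<gamma> * t) - exp (\<gamma> * 0)"
      using \<open>0 \<le> t\<close>
      by (intro integral_FTC_Icc_real[where F = "\<lambda>s. exp (\<gamma> * s)"])
         (auto intro!: derivative_eq_intros continuous_intros)
    then show ?thesis by (simp add: set_lebesgue_integral_def mult_ac)
  qed
  have E': "(LINT s:{0..t}|lborel. \<alpha> * exp (\<gamma> * s)) = \<alpha> / \<gamma> * (exp (\<gamma> * t) - 1)"
  proof -
    have "(LINT s:{0..t}|lborel. \<alpha> * exp (\<gamma> * s)) =
      (LINT s:{0..t}|lborel. \<alpha> / \<gamma> * (\<gamma> * exp (\<gamma> * s)))"
      using \<open>\<gamma> \<noteq> 0\<close> by simp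
    then show ?thesis using E by (simp only: set_integral_mult_right)
  qed
  \<comment> \<open>Subtracting \<open>x\<close> from \<open>f\<close> leaves the pure integral of
    \<open>\<phi>\<close>, the form to which the Fubini identity applies.\<close>
  have "(LINT s:{0..t}|lborel. exp (\<gamma> * s) * \<gamma> * f s - \<gamma> * exp (\<gamma> * s) * x) =
    (LINT s:{0..t}|lborel. \<gamma> * exp (\<gamma> * s) * (LINT u:{0..s}|lborel. \<phi> u))"
    by (intro set_lebesgue_integral_cong) (auto simp: f algebra_simps)
  also have "\<dots> = (LINT u:{0..t}|lborel. exp (\<gamma> * t) * \<phi> u - exp (\<gamma> * u) * \<phi> u)"
    unfolding LINT_exp_by_parts[OF \<phi> \<open>0 \<le> t\<close>] by (simp add: algebra_simps)
  also have "\<dots> = exp (\<gamma> * t) * (f t - x) - (LINT u:{0..t}|lborel. exp (\<gamma> * u) * \<phi> u)"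
    using \<phi> exp\<phi> \<open>0 \<le> t\<close> by (simp add: f)
  finally have F: "(LINT s:{0..t}|lborel. exp (\<gamma> * s) * \<gamma> * f s - \<gamma> * exp (\<gamma> * s) * x) =
    exp (\<gamma> * t) * (f t - x) - (LINT u:{0..t}|lborel. exp (\<gamma> * u) * \<phi> u)" .
  have "(LINT s:{0..t}|lborel. exp (\<gamma> * s) * (\<phi> s - \<alpha> + \<gamma> * f s)) =
    (LINT s:{0..t}|lborel. (exp (\<gamma> * s) * \<phi> s - \<alpha> * exp (\<gamma> * s)) +
      ((exp (\<gamma> * s) * \<gamma> * f s - \<gamma> * exp (\<gamma> * s) * x) + \<gamma> * exp (\<gamma> * s) * x))"
    by (intro set_lebesgue_integral_cong) (auto simp: algebra_simps)
  also have "\<dots> = (LINT s:{0..t}|lborel. exp (\<gamma> * s) * \<phi> s) - (LINT s:{0..t}|lborel. \<alpha> * exp (\<gamma> * s)) +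
      ((LINT s:{0..t}|lborel. exp (\<gamma> * s) * \<gamma> * f s - \<gamma> * exp (\<gamma> * s) * x) +
       (LINT s:{0..t}|lborel. \<gamma> * exp (\<gamma> * s) * x))"
    using exp\<phi> 2 3 4 by (simp only: set_integral_add set_integral_diff)
  also have "\<dots> = exp (\<gamma> * t) * f t - x - \<alpha> / \<gamma> * (exp (\<gamma> * t) - 1)"
    unfolding F E' set_integral_mult_left E by (simp add: algebra_simps)
  finally show ?thesis .
qed

section \<open>Square integrable densities and the rate function\<close>

text \<open>\<open>deriv\<close> is two-sided and \<open>g\<close> is arbitrary outside the
  interval, so the two end points go into the exceptional null set; at interior points only values
  inside the interval matter.\<close>

lemma deriv_AE_eq_integrand:
  fixes g \<phi> :: "real \<Rightarrow> real"
  assumes g: "\<And>t. t \<in> {0..T} \<Longrightarrow> g t = x + (LINT s:{0..t}|lborel. \<phi> s)"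
    and \<phi>: "set_integrable lborel {0..T} \<phi>"
  shows "AE t in lborel. t \<in> {0..T} \<longrightarrow> deriv g t = \<phi> t"
proof -
  have "AE t in lborel. t \<notin> {0, T}"
    by (intro AE_not_in finite_imp_null_set_lborel) simp
  with AE_has_derivative_LINT[OF \<phi>] show ?thesis
  proof eventually_elim
    case (elim t)
    show ?case
    proof
      assume t: "t \<in> {0..T}"
      have "((\<lambda>u. x + (LINT s:{0..u}|lborel. \<phi> s)) has_real_derivative \<phi> t) (at t)"
        using elim t by (auto intro!: derivative_eq_intros)
      then have "(g has_real_derivative \<phi> t) (at t)"
        by (rule has_field_derivative_transform_within_open[where S = "{0<..<T}"]) (use t elim g in auto)
      then show "deriv g t = \<phi> t" by (rule DERIV_imp_deriv)
    qed
  qed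
qed

lemma set_integrable_L2_on:
  assumes "\<phi> \<in> L2_on T"
  shows "set_integrable lborel {0..T} \<phi>"
proof (rule set_integrable_bound[where f = "\<lambda>t. 1 + (\<phi> t)\<^sup>2"])
  have "set_integrable lborel {0..T} (\<lambda>_. 1 :: real)"
    by (simp add: borel_integrable_atLeastAtMost')
  then show "set_integrable lborel {0..T} (\<lambda>t. 1 + (\<phi> t)\<^sup>2)"
    using assms by (auto simp: L2_on_def)
  have "\<bar>u\<bar> \<le> 1 + u\<^sup>2" for u :: real
    using sum_power2_ge_zero[of "\<bar>u\<bar> - 1" 0] by (simp add: power2_diff)
  then show "AE t in lborel. t \<in> {0..T} \<longrightarrow> norm (\<phi> t) \<le> norm (1 + (\<phi> t)\<^sup>2)"
    by auto
qed (use assms in \<open>auto simp: L2_on_def\<close>)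

lemma L2_on_add_continuous:
  assumes "\<phi> \<in> L2_on T" "continuous_on {0..T} h"
  shows "(\<lambda>t. \<phi> t + h t) \<in> L2_on T"
proof -
  have h: "set_integrable lborel {0..T} h" "set_integrable lborel {0..T} (\<lambda>t. (h t)\<^sup>2)"
    using assms(2) by (auto intro!: borel_integrable_atLeastAtMost' continuous_intros)
  have 1: "set_borel_measurable lborel {0..T} (\<lambda>t. \<phi> t + h t)"
  proof -
    have "(\<lambda>t. indicator {0..T} t *\<^sub>R \<phi> t + indicator {0..T} t *\<^sub>R h t) \<in> borel_measurable lborel"
      using h(1) assms(1) by (intro borel_measurable_add) (auto simp: L2_on_def set_integrable_def set_borel_measurable_def)
    then show ?thesis by (simp add: set_borel_measurable_def algebra_simps)
  qed
  moreover have "set_integrable lborel {0..T} (\<lambda>t. (\<phi> t + h t)\<^sup>2)"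
  proof (rule set_integrable_bound[where f = "\<lambda>t. 2 * (\<phi> t)\<^sup>2 + 2 * (h t)\<^sup>2"])
    show "set_integrable lborel {0..T} (\<lambda>t. 2 * (\<phi> t)\<^sup>2 + 2 * (h t)\<^sup>2)"
      using h(2) assms(1) by (auto simp: L2_on_def)
    \<comment> \<open>Measurability is known for the function cut off to the interval; squaring the
      cut-off is the same as cutting off the square.\<close>
    have "(\<lambda>t. (indicator {0..T} t *\<^sub>R (\<phi> t + h t))\<^sup>2) \<in> borel_measurable lborel"
      using 1 by (intro borel_measurable_power) (simp add: set_borel_measurable_def)
    then show "set_borel_measurable lborel {0..T} (\<lambda>t. (\<phi> t + h t)\<^sup>2)"
      unfolding set_borel_measurable_def
      by (rule back_subst[where P = "\<lambda>f. f \<in> borel_measurable lborel"]) (auto simp: indicator_def)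
    have "(u + v)\<^sup>2 \<le> 2 * u\<^sup>2 + 2 * v\<^sup>2" for u v :: real
      using zero_le_power2[of "u - v"] by (simp add: power2_sum power2_diff)
    then show "AE t in lborel. t \<in> {0..T} \<longrightarrow>
        norm ((\<phi> t + h t)\<^sup>2) \<le> norm (2 * (\<phi> t)\<^sup>2 + 2 * (h t)\<^sup>2)"
      by auto
  qed
  ultimately show ?thesis by (simp add: L2_on_def)
qed

text \<open>Makes the cost a real integral over a density: off a null set the derivative may be
  exchanged for \<open>\<phi>\<close>, and the control is square integrable, so that the nonnegative
  integral is finite and equals the Lebesgue integral.\<close>

lemma I_plus_eq_LINT:
  assumes "g \<in> H_plus T x" and \<phi>: "\<phi> \<in> L2_on T" and cont: "continuous_on {0..T} g"
    and g: "\<And>t. t \<in> {0..T} \<Longrightarrow> g t = x + (LINT s:{0..t}|lborel. \<phi> s)"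
  shows "I_plus \<alpha> \<gamma> \<sigma> T x g =
    ennreal (1 / (2 * \<sigma>\<^sup>2) * (LINT t:{0..T}|lborel. (\<phi> t - \<alpha> + \<gamma> * g t)\<^sup>2))"
proof -
  have L2: "(\<lambda>t. \<phi> t - \<alpha> + \<gamma> * g t) \<in> L2_on T"
    using L2_on_add_continuous[OF \<phi>, of "\<lambda>t. \<gamma> * g t - \<alpha>"]
    by (simp add: continuous_intros cont algebra_simps)
  then have int: "set_integrable lborel {0..T} (\<lambda>t. (\<phi> t - \<alpha> + \<gamma> * g t)\<^sup>2)"
    by (simp add: L2_on_def)
  have "(\<integral>\<^sup>+ t\<in>{0..T}. ennreal ((deriv g t - \<alpha> + \<gamma> * g t)\<^sup>2) \<partial>lborel) =
    (\<integral>\<^sup>+ t. ennreal (indicator {0..T} t *\<^sub>R (\<phi> t - \<alpha> + \<gamma> * g t)\<^sup>2) \<partial>lborel)"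
    using deriv_AE_eq_integrand[OF g set_integrable_L2_on[OF \<phi>]]
    by (intro nn_integral_cong_AE) (auto simp: indicator_def elim!: eventually_mono)
  also have "\<dots> = ennreal (LINT t:{0..T}|lborel. (\<phi> t - \<alpha> + \<gamma> * g t)\<^sup>2)"
    unfolding set_lebesgue_integral_def
    using int by (intro nn_integral_eq_integral) (auto simp: set_integrable_def)
  finally show ?thesis
    using assms(1) unfolding I_plus_def by (simp only: if_True, subst ennreal_mult') simp_all
qed

text \<open>The mean is a convex combination of \<open>\<alpha> / \<gamma>\<close> and
  \<open>x\<close>.\<close>

lemma ou_mean_nonneg:
  assumes "0 < \<alpha>" "0 < \<gamma>" "0 \<le> x" "0 \<le> t"
  shows "0 \<le> ou_mean \<alpha> \<gamma> x t"
proof -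
  have "ou_mean \<alpha> \<gamma> x t = \<alpha> / \<gamma> * (1 - exp (- \<gamma> * t)) + x * exp (- \<gamma> * t)"
    by (simp add: ou_mean_def algebra_simps)
  also have "\<dots> \<ge> 0"
    using assms by (intro add_nonneg_nonneg mult_nonneg_nonneg) auto
  finally show ?thesis .
qed

section \<open>The minimal cost path\<close>

context
  fixes \<alpha> \<gamma> \<sigma> T x b :: real
  assumes \<alpha>: "0 < \<alpha>" and \<gamma>: "0 < \<gamma>" and \<sigma>: "0 < \<sigma>" and T: "0 < T" and x: "0 \<le> x"
    and b: "ou_mean \<alpha> \<gamma> x T < b"
begin

lemma exp_diff_pos: "0 < exp (\<gamma> * T) - exp (- \<gamma> * T)"
  using \<gamma> T by (simp add: mult_pos_pos order_less_trans[of _ 0])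

text \<open>From this form one reads off the sign of the growing exponential in
  \<open>f_star\<close> and the end value of \<open>f_star\<close>: both come from the gap between
  \<open>b\<close> and the uncontrolled end value.\<close>

lemma C_const_eq: "C_const \<alpha> \<gamma> T x b - \<alpha> / \<gamma> =
    (b - ou_mean \<alpha> \<gamma> x T) / (exp (\<gamma> * T) - exp (- \<gamma> * T))"
proof -
  have "u / d - a = (u - a * d) / d" if "0 < d" for u d a :: real
    using that by (simp add: field_simps)
  from this[OF exp_diff_pos] show ?thesis
    unfolding C_const_def ou_mean_def
    by (simp only:) (rule arg_cong2[where f = "(/)"], auto simp: algebra_simps)
qed

lemma C_const_gt: "\<alpha> / \<gamma> < C_const \<alpha> \<gamma> T x b"
proof -
  have "0 < C_const \<alpha> \<gamma> T x b - \<alpha> / \<gamma>"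
    unfolding C_const_eq using b exp_diff_pos by simp
  then show ?thesis by simp
qed

text \<open>The correction to the mean path is a multiple of \<open>2 * sinh (\<gamma> * t)\<close>:
  it vanishes at 0, is nonnegative, and lifts the end point to \<open>b\<close>.\<close>

lemma f_star_eq: "f_star \<alpha> \<gamma> T x b t =
    ou_mean \<alpha> \<gamma> x t + (C_const \<alpha> \<gamma> T x b - \<alpha> / \<gamma>) * (exp (\<gamma> * t) - exp (- \<gamma> * t))"
  by (simp add: f_star_def ou_mean_def algebra_simps)

lemma f_star_T: "f_star \<alpha> \<gamma> T x b T = b"
  unfolding f_star_eq C_const_eq using exp_diff_pos by (simp only: times_divide_eq_left nonzero_mult_div_cancel_right)

lemma f_star_0: "f_star \<alpha> \<gamma> T x b 0 = x"
  by (simp add: f_star_def)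

lemma f_star_nonneg: "0 \<le> t \<Longrightarrow> 0 \<le> f_star \<alpha> \<gamma> T x b t"
  unfolding f_star_eq using C_const_gt \<gamma> ou_mean_nonneg[OF \<alpha> \<gamma> x, of t]
  by (intro add_nonneg_nonneg mult_nonneg_nonneg) (auto intro: order_trans[of _ 0])

definition "f_star' = (\<lambda>t. (C_const \<alpha> \<gamma> T x b - \<alpha> / \<gamma>) * (\<gamma> * exp (\<gamma> * t)) -
   (x - C_const \<alpha> \<gamma> T x b) * (\<gamma> * exp (- \<gamma> * t)))"

lemma f_star_has_derivative: "(f_star \<alpha> \<gamma> T x b has_real_derivative f_star' t) (at t within S)"
  unfolding f_star_def[abs_def] f_star'_def
  by (auto intro!: derivative_eq_intros simp: algebra_simps)

lemma continuous_f_star': "continuous_on A f_star'"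
  unfolding f_star'_def by (intro continuous_intros)

lemma f_star_integral:
  assumes "0 \<le> t"
  shows "f_star \<alpha> \<gamma> T x b t = x + (LINT s:{0..t}|lborel. f_star' s)"
proof -
  have "(LINT s:{0..t}|lborel. f_star' s) = f_star \<alpha> \<gamma> T x b t - f_star \<alpha> \<gamma> T x b 0"
    unfolding set_lebesgue_integral_def
    using assms f_star_has_derivative continuous_f_star'
    by (intro integral_FTC_Icc) (auto simp flip: has_real_derivative_iff_has_vector_derivative)
  then show ?thesis by (simp add: f_star_0)
qed

text \<open>Amplitude of the control of \<open>f_star\<close>. In
  \<open>f_star' + \<gamma> f_star\<close> the growing exponential doubles, which yields the factor
  2, and the decaying one cancels.\<close>

definition "f_star_gain = 2 * \<gamma> * (C_const \<alpha> \<gamma> T x b - \<alpha> / \<gamma>)"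

lemma f_star_control: "f_star' t - \<alpha> + \<gamma> * f_star \<alpha> \<gamma> T x b t = f_star_gain * exp (\<gamma> * t)"
  using \<gamma> by (simp add: f_star'_def f_star_def f_star_gain_def field_simps)

lemma f_star_mem:
  "restrict (f_star \<alpha> \<gamma> T x b) {0..T} \<in> S_plus T x b"
  "restrict (f_star \<alpha> \<gamma> T x b) {0..T} \<in> H_plus T x"
  "f_star' \<in> L2_on T"
  "continuous_on {0..T} (restrict (f_star \<alpha> \<gamma> T x b) {0..T})"
proof -
  show c: "continuous_on {0..T} (restrict (f_star \<alpha> \<gamma> T x b) {0..T})"
  proof -
    have "continuous_on {0..T} (f_star \<alpha> \<gamma> T x b)"
      unfolding f_star_def[abs_def] by (intro continuous_intros)
    then show ?thesis by (rule continuous_on_cong[THEN iffD1, rotated -1]) auto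
  qed
  then show "restrict (f_star \<alpha> \<gamma> T x b) {0..T} \<in> S_plus T x b"
    using T by (auto simp: S_plus_def nonneg_paths_def f_star_nonneg f_star_0 f_star_T)
  show L: "f_star' \<in> L2_on T"
    unfolding L2_on_def
    using borel_measurable_continuous_onI[OF continuous_f_star']
    by (auto intro!: borel_integrable_atLeastAtMost' continuous_intros continuous_f_star'
        simp: set_borel_measurable_def)
  show "restrict (f_star \<alpha> \<gamma> T x b) {0..T} \<in> H_plus T x"
    unfolding H_plus_def H_def using L f_star_integral f_star_nonneg by auto
qed

text \<open>The squared control is expanded around the control of \<open>f_star\<close>; by
  \<open>LINT_exp_weighted\<close> the cross term depends only on the end values \<open>g T\<close>
  and \<open>b\<close>. For \<open>b \<le> g T\<close> the last two terms are nonnegative, because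
  \<open>f_star_gain\<close> is positive, and they measure the excess over the minimal cost.\<close>

lemma cost_decomposition:
  assumes \<phi>: "\<phi> \<in> L2_on T" and cont: "continuous_on {0..T} g"
    and g: "\<And>t. t \<in> {0..T} \<Longrightarrow> g t = x + (LINT s:{0..t}|lborel. \<phi> s)"
  shows "(LINT t:{0..T}|lborel. (\<phi> t - \<alpha> + \<gamma> * g t)\<^sup>2) =
    (LINT t:{0..T}|lborel. (f_star_gain * exp (\<gamma> * t))\<^sup>2) +
    (LINT t:{0..T}|lborel. (\<phi> t - \<alpha> + \<gamma> * g t - f_star_gain * exp (\<gamma> * t))\<^sup>2) +
    2 * f_star_gain * exp (\<gamma> * T) * (g T - b)"
proof -
  define \<psi> where "\<psi> = (\<lambda>t. \<phi> t - \<alpha> + \<gamma> * g t)"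
  have L2: "\<psi> \<in> L2_on T"
    using L2_on_add_continuous[OF \<phi>, of "\<lambda>t. \<gamma> * g t - \<alpha>"]
    by (simp add: continuous_intros cont algebra_simps \<psi>_def)
  have L2': "(\<lambda>t. \<psi> t - f_star_gain * exp (\<gamma> * t)) \<in> L2_on T"
    using L2_on_add_continuous[OF L2, of "\<lambda>t. - (f_star_gain * exp (\<gamma> * t))"]
    by (simp add: continuous_intros)
  have i1: "set_integrable lborel {0..T} (\<lambda>t. (\<psi> t)\<^sup>2)"
    and i2: "set_integrable lborel {0..T} (\<lambda>t. (\<psi> t - f_star_gain * exp (\<gamma> * t))\<^sup>2)"
    and i3: "set_integrable lborel {0..T} (\<lambda>t. (f_star_gain * exp (\<gamma> * t))\<^sup>2)"
    using L2 L2' by (auto simp: L2_on_def intro!: borel_integrable_atLeastAtMost' continuous_intros)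
  have kpos: "f_star_gain > 0" using C_const_gt \<gamma> by (simp add: f_star_gain_def)
  \<comment> \<open>Polarization: the product of \<open>\<psi>\<close> with the exponential is a
    combination of three integrable squares.\<close>
  have "set_integrable lborel {0..T} (\<lambda>t. ((\<psi> t)\<^sup>2 + (f_star_gain * exp (\<gamma> * t))\<^sup>2 - (\<psi> t - f_star_gain * exp (\<gamma> * t))\<^sup>2) / (2 * f_star_gain))"
    using i1 i2 i3 by (intro set_integrable_divide set_integral_add set_integral_diff) auto
  then have i4: "set_integrable lborel {0..T} (\<lambda>t. exp (\<gamma> * t) * \<psi> t)"
    using kpos by (simp add: power2_diff field_simps)
  have i5: "set_integrable lborel {0..T} (\<lambda>t. exp (\<gamma> * t) * (f_star_gain * exp (\<gamma> * t)))"
    by (auto intro!: borel_integrable_atLeastAtMost' continuous_intros)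
  have A: "(LINT t:{0..T}|lborel. exp (\<gamma> * t) * \<psi> t) =
      exp (\<gamma> * T) * g T - x - \<alpha> / \<gamma> * (exp (\<gamma> * T) - 1)"
    unfolding \<psi>_def using T \<gamma> g cont set_integrable_L2_on[OF \<phi>]
    by (intro LINT_exp_weighted) auto
  \<comment> \<open>The exponential is recognized as the control of \<open>f_star\<close>, so the
    end value identity with end value \<open>b\<close> replaces a computation of the
    integral.\<close>
  have B: "(LINT t:{0..T}|lborel. exp (\<gamma> * t) * (f_star_gain * exp (\<gamma> * t))) =
      exp (\<gamma> * T) * b - x - \<alpha> / \<gamma> * (exp (\<gamma> * T) - 1)"
  proof -
    have "(LINT t:{0..T}|lborel. exp (\<gamma> * t) * (f_star' t - \<alpha> + \<gamma> * f_star \<alpha> \<gamma> T x b t)) =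
        exp (\<gamma> * T) * f_star \<alpha> \<gamma> T x b T - x - \<alpha> / \<gamma> * (exp (\<gamma> * T) - 1)"
      using T \<gamma> f_star_integral set_integrable_L2_on[OF f_star_mem(3)]
      by (intro LINT_exp_weighted) (auto simp: f_star_def[abs_def] intro!: continuous_intros)
    then show ?thesis by (simp only: f_star_control f_star_T)
  qed
  have "(LINT t:{0..T}|lborel. (\<psi> t)\<^sup>2) = (LINT t:{0..T}|lborel. ((f_star_gain * exp (\<gamma> * t))\<^sup>2 +
     (\<psi> t - f_star_gain * exp (\<gamma> * t))\<^sup>2) + 2 * f_star_gain * (exp (\<gamma> * t) * \<psi> t - exp (\<gamma> * t) * (f_star_gain * exp (\<gamma> * t))))"
    by (intro set_lebesgue_integral_cong) (auto simp: power2_eq_square algebra_simps)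
  also have "\<dots> = (LINT t:{0..T}|lborel. (f_star_gain * exp (\<gamma> * t))\<^sup>2) +
     (LINT t:{0..T}|lborel. (\<psi> t - f_star_gain * exp (\<gamma> * t))\<^sup>2) +
     2 * f_star_gain * ((LINT t:{0..T}|lborel. exp (\<gamma> * t) * \<psi> t) - (LINT t:{0..T}|lborel. exp (\<gamma> * t) * (f_star_gain * exp (\<gamma> * t))))"
    using i2 i3 i4 i5 by (simp only: set_integral_add set_integral_diff set_integral_mult_right set_integrable_mult_right)
  also have "2 * f_star_gain * ((LINT t:{0..T}|lborel. exp (\<gamma> * t) * \<psi> t) - (LINT t:{0..T}|lborel. exp (\<gamma> * t) * (f_star_gain * exp (\<gamma> * t)))) =
     2 * f_star_gain * exp (\<gamma> * T) * (g T - b)"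
    unfolding A B by (simp add: algebra_simps)
  finally show ?thesis unfolding \<psi>_def .
qed


text \<open>A path is determined by its starting point and its control: equal controls give equal
  weighted integrals over \<open>{0..t}\<close>, and \<open>LINT_exp_weighted\<close> turns these
  into equal values at \<open>t\<close>.\<close>

lemma restrict_eq_of_control_eq:
  assumes \<phi>: "set_integrable lborel {0..T} \<phi>" and cont: "continuous_on {0..T} g"
    and g: "\<And>t. t \<in> {0..T} \<Longrightarrow> g t = x + (LINT s:{0..t}|lborel. \<phi> s)"
    and eq: "AE t in lborel. t \<in> {0..T} \<longrightarrow> \<phi> t - \<alpha> + \<gamma> * g t = f_star_gain * exp (\<gamma> * t)"
    and t: "t \<in> {0..T}"
  shows "g t = f_star \<alpha> \<gamma> T x b t"
proof -
  have "set_integrable lborel {0..t} \<phi>"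
    by (rule set_integrable_subset[OF \<phi>]) (use t in auto)
  moreover have "continuous_on {0..t} g"
    by (rule continuous_on_subset[OF cont]) (use t in auto)
  ultimately have A: "(LINT s:{0..t}|lborel. exp (\<gamma> * s) * (\<phi> s - \<alpha> + \<gamma> * g s)) =
      exp (\<gamma> * t) * g t - x - \<alpha> / \<gamma> * (exp (\<gamma> * t) - 1)"
    using t \<gamma> g by (intro LINT_exp_weighted) auto
  have B: "(LINT s:{0..t}|lborel. exp (\<gamma> * s) * (f_star' s - \<alpha> + \<gamma> * f_star \<alpha> \<gamma> T x b s)) =
      exp (\<gamma> * t) * f_star \<alpha> \<gamma> T x b t - x - \<alpha> / \<gamma> * (exp (\<gamma> * t) - 1)"
    using t \<gamma> f_star_integral
    by (intro LINT_exp_weighted borel_integrable_atLeastAtMost' continuous_f_star')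
       (auto simp: f_star_def[abs_def] intro!: continuous_intros)
  have "(LINT s:{0..t}|lborel. exp (\<gamma> * s) * (\<phi> s - \<alpha> + \<gamma> * g s)) =
      (LINT s:{0..t}|lborel. exp (\<gamma> * s) * (f_star' s - \<alpha> + \<gamma> * f_star \<alpha> \<gamma> T x b s))"
    unfolding set_lebesgue_integral_def
  proof (rule integral_cong_AE)
    \<comment> \<open>\<open>integral_cong_AE\<close> asks for measurable integrands. Measurability
      of \<open>\<phi>\<close> and \<open>g\<close> is known after cutting off to
      \<open>{0..T}\<close>, which changes nothing on \<open>{0..t}\<close>.\<close>
    have "(\<lambda>s. indicator {0..T} s *\<^sub>R \<phi> s) \<in> borel_measurable lborel"
      using \<phi> by (simp add: set_integrable_def)
    moreover have "(\<lambda>s. indicator {0..T} s *\<^sub>R g s) \<in> borel_measurable lborel"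
      using borel_integrable_atLeastAtMost'[OF cont] by (simp add: set_integrable_def)
    ultimately have "(\<lambda>s. indicator {0..t} s * (exp (\<gamma> * s) * (indicator {0..T} s *\<^sub>R \<phi> s - \<alpha> + \<gamma> * (indicator {0..T} s *\<^sub>R g s)))) \<in> borel_measurable lborel"
      by measurable
    then show "(\<lambda>s. indicator {0..t} s *\<^sub>R (exp (\<gamma> * s) * (\<phi> s - \<alpha> + \<gamma> * g s))) \<in> borel_measurable lborel"
      by (rule back_subst[where P = "\<lambda>f. f \<in> borel_measurable lborel"]) (use t in \<open>auto simp: indicator_def\<close>)
    show "(\<lambda>s. indicator {0..t} s *\<^sub>R (exp (\<gamma> * s) * (f_star' s - \<alpha> + \<gamma> * f_star \<alpha> \<gamma> T x b s))) \<in> borel_measurable lborel"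
      unfolding f_star_control by measurable
    show "AE s in lborel. indicator {0..t} s *\<^sub>R (exp (\<gamma> * s) * (\<phi> s - \<alpha> + \<gamma> * g s)) =
        indicator {0..t} s *\<^sub>R (exp (\<gamma> * s) * (f_star' s - \<alpha> + \<gamma> * f_star \<alpha> \<gamma> T x b s))"
      using eq unfolding f_star_control
      by eventually_elim (use t in \<open>auto simp: indicator_def\<close>)
  qed
  then show ?thesis unfolding A B by simp
qed

text \<open>Outside \<open>H_plus\<close> the cost is infinite, whereas that of
  \<open>f_star\<close> is finite. Inside, \<open>cost_decomposition\<close> leaves two nonnegative
  excess terms; a competitor that is no more expensive has zero quadratic excess, hence the same
  control almost everywhere, hence the same path.\<close>

lemma minimizers_I_plus:
  "minimizers (I_plus \<alpha> \<gamma> \<sigma> T x) (S_plus T x b) = {restrict (f_star \<alpha> \<gamma> T x b) {0..T}}"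
proof -
  let ?f = "restrict (f_star \<alpha> \<gamma> T x b) {0..T}"
  let ?c = "1 / (2 * \<sigma>\<^sup>2)"
  let ?J = "LINT t:{0..T}|lborel. (f_star_gain * exp (\<gamma> * t))\<^sup>2"
  have kpos: "f_star_gain > 0" using C_const_gt \<gamma> by (simp add: f_star_gain_def)
  have c: "?c > 0" using \<sigma> by simp
  have J: "0 \<le> ?J" by (simp add: set_lebesgue_integral_def)
  have If: "I_plus \<alpha> \<gamma> \<sigma> T x ?f = ennreal (?c * ?J)"
  proof -
    have "I_plus \<alpha> \<gamma> \<sigma> T x ?f =
      ennreal (?c * (LINT t:{0..T}|lborel. (f_star' t - \<alpha> + \<gamma> * ?f t)\<^sup>2))"
      using f_star_mem f_star_integral by (intro I_plus_eq_LINT) auto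
    also have "(LINT t:{0..T}|lborel. (f_star' t - \<alpha> + \<gamma> * ?f t)\<^sup>2) = ?J"
      by (intro set_lebesgue_integral_cong) (auto simp: f_star_control)
    finally show ?thesis .
  qed
  have main: "I_plus \<alpha> \<gamma> \<sigma> T x ?f \<le> I_plus \<alpha> \<gamma> \<sigma> T x g \<and>
      (I_plus \<alpha> \<gamma> \<sigma> T x g \<le> I_plus \<alpha> \<gamma> \<sigma> T x ?f \<longrightarrow> g = ?f)" if gS: "g \<in> S_plus T x b" for g
  proof (cases "g \<in> H_plus T x")
    case False
    then have "I_plus \<alpha> \<gamma> \<sigma> T x g = \<infinity>" by (simp add: I_plus_def)
    then show ?thesis unfolding If by (simp add: top_unique)
  next
    case True
    then obtain \<phi> where \<phi>: "\<phi> \<in> L2_on T"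
      and g: "\<And>t. t \<in> {0..T} \<Longrightarrow> g t = x + (LINT s:{0..t}|lborel. \<phi> s)"
      by (auto simp: H_plus_def H_def)
    have cont: "continuous_on {0..T} g" and gT: "b \<le> g T" and ext: "g \<in> extensional {0..T}"
      using gS by (auto simp: S_plus_def nonneg_paths_def PiE_def)
    let ?d = "\<lambda>t. \<phi> t - \<alpha> + \<gamma> * g t - f_star_gain * exp (\<gamma> * t)"
    let ?D = "LINT t:{0..T}|lborel. (?d t)\<^sup>2"
    let ?E = "2 * f_star_gain * exp (\<gamma> * T) * (g T - b)"
    have Ig: "I_plus \<alpha> \<gamma> \<sigma> T x g = ennreal (?c * (?J + ?D + ?E))"
      using I_plus_eq_LINT[OF True \<phi> cont g] cost_decomposition[OF \<phi> cont g] by simp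
    have D: "0 \<le> ?D" by (simp add: set_lebesgue_integral_def)
    have E: "0 \<le> ?E" using kpos gT by simp
    have "g = ?f" if "I_plus \<alpha> \<gamma> \<sigma> T x g \<le> I_plus \<alpha> \<gamma> \<sigma> T x ?f"
    proof -
      have "?c * (?J + ?D + ?E) \<le> ?c * ?J"
        using that J unfolding Ig If by (subst (asm) ennreal_le_iff) simp_all
      then have "?J + ?D + ?E \<le> ?J"
        using c by (rule mult_left_le_imp_le)
      then have D0: "?D = 0"
        using D E by linarith
      have "(\<lambda>t. ?d t) \<in> L2_on T"
        using L2_on_add_continuous[OF \<phi>, of "\<lambda>t. \<gamma> * g t - \<alpha> - f_star_gain * exp (\<gamma> * t)"]
        by (simp add: continuous_intros cont algebra_simps)
      then have "integrable lborel (\<lambda>t. indicator {0..T} t *\<^sub>R (?d t)\<^sup>2)"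
        by (simp add: L2_on_def set_integrable_def)
      then have "AE t in lborel. indicator {0..T} t *\<^sub>R (?d t)\<^sup>2 = 0"
        using D0 unfolding set_lebesgue_integral_def
        by (subst (asm) integral_nonneg_eq_0_iff_AE) auto
      then have "AE t in lborel. t \<in> {0..T} \<longrightarrow> \<phi> t - \<alpha> + \<gamma> * g t = f_star_gain * exp (\<gamma> * t)"
        by eventually_elim auto
      from restrict_eq_of_control_eq[OF set_integrable_L2_on[OF \<phi>] cont g this]
      show "g = ?f"
        using ext by (intro extensionalityI[of _ "{0..T}"]) auto
    qed
    moreover have "I_plus \<alpha> \<gamma> \<sigma> T x ?f \<le> I_plus \<alpha> \<gamma> \<sigma> T x g"
      unfolding Ig If using c D E by (intro ennreal_leI mult_left_mono) auto
    ultimately show ?thesis by blast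
  qed
  show ?thesis
    unfolding minimizers_def using main f_star_mem(1) by blast
qed

end

section \<open>Pathwise analysis of the reflected equation\<close>

text \<open>The Wiener integral \<open>\<integral>\<^sub>\<tau>\<^sup>T exp (- \<gamma> (T - s)) dw(s)\<close>, made pathwise by partial integration.\<close>
definition exp_weighted_increment :: "real \<Rightarrow> real \<Rightarrow> (real \<Rightarrow> real) \<Rightarrow> real \<Rightarrow> real" where
  "exp_weighted_increment \<gamma> T w \<tau> =
     w T - exp (- \<gamma> * (T - \<tau>)) * w \<tau> - integral {\<tau>..T} (\<lambda>s. \<gamma> * exp (- \<gamma> * (T - s)) * w s)"

lemma integral_exp_weight:
  fixes \<gamma> T \<tau> t :: real
  assumes "\<tau> \<le> t"
  shows "((\<lambda>s. \<gamma> * exp (- \<gamma> * (T - s))) has_integral exp (- \<gamma> * (T - t)) - exp (- \<gamma> * (T - \<tau>))) {\<tau>..t}"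
  using assms
  by (intro fundamental_theorem_of_calculus[where f = "\<lambda>s. exp (- \<gamma> * (T - s))"])
     (auto intro!: derivative_eq_intros simp flip: has_real_derivative_iff_has_vector_derivative)

lemma exp_weighted_increment_cmult:
  "exp_weighted_increment \<gamma> T (\<lambda>s. c * w s) \<tau> = c * exp_weighted_increment \<gamma> T w \<tau>"
proof -
  have "integral {\<tau>..T} (\<lambda>s. \<gamma> * exp (- \<gamma> * (T - s)) * (c * w s)) =
    integral {\<tau>..T} (\<lambda>s. c * (\<gamma> * exp (- \<gamma> * (T - s)) * w s))"
    by (simp add: mult_ac)
  then show ?thesis
    unfolding exp_weighted_increment_def by (simp add: algebra_simps del: mult_minus_left)
qed

text \<open>Bounding \<open>l\<close> by \<open>l T\<close> under the integral leaves the total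
  increase times the smallest weight, the one at \<open>\<tau>\<close>. Consequently a regulator can
  only raise the end value.\<close>

lemma exp_weighted_increment_mono:
  assumes "0 < \<gamma>" "\<tau> \<le> T" "mono_on {\<tau>..T} l" "continuous_on {\<tau>..T} l"
  shows "l T - l \<tau> \<ge> 0" "exp_weighted_increment \<gamma> T l \<tau> \<ge> exp (- \<gamma> * (T - \<tau>)) * (l T - l \<tau>)"
proof -
  show "l T - l \<tau> \<ge> 0" using assms by (auto dest: mono_onD)
  have "integral {\<tau>..T} (\<lambda>s. \<gamma> * exp (- \<gamma> * (T - s)) * l s) \<le>
      integral {\<tau>..T} (\<lambda>s. \<gamma> * exp (- \<gamma> * (T - s)) * l T)"
    using assms
    by (intro integral_le integrable_continuous_real continuous_intros mult_left_mono)
       (auto intro: mono_onD[OF \<open>mono_on {\<tau>..T} l\<close>])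
  also have "\<dots> = (1 - exp (- \<gamma> * (T - \<tau>))) * l T"
    using integral_unique[OF has_integral_mult_left[OF integral_exp_weight[OF \<open>\<tau> \<le> T\<close>, of \<gamma> T], of "l T"]] by simp
  finally show "exp_weighted_increment \<gamma> T l \<tau> \<ge> exp (- \<gamma> * (T - \<tau>)) * (l T - l \<tau>)"
    unfolding exp_weighted_increment_def by (simp add: algebra_simps del: mult_minus_left)
qed

lemma exp_weighted_increment_const:
  fixes \<gamma> T \<tau> c :: real
  assumes "\<tau> \<le> T" "\<And>s. s \<in> {\<tau>..T} \<Longrightarrow> l s = c"
  shows "exp_weighted_increment \<gamma> T l \<tau> = 0"
proof -
  have "integral {\<tau>..T} (\<lambda>s. \<gamma> * exp (- \<gamma> * (T - s)) * l s) =
      integral {\<tau>..T} (\<lambda>s. \<gamma> * exp (- \<gamma> * (T - s)) * c)"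
    using assms by (intro integral_cong) auto
  also have "\<dots> = (1 - exp (- \<gamma> * (T - \<tau>))) * c"
    using integral_unique[OF has_integral_mult_left[OF integral_exp_weight[OF \<open>\<tau> \<le> T\<close>, of \<gamma> T], of c]] by simp
  finally show ?thesis
    unfolding exp_weighted_increment_def using assms by (simp add: algebra_simps del: mult_minus_left)
qed

text \<open>Variation of constants: \<open>z = y - w - l\<close> is differentiable and solves a linear equation.\<close>
lemma ou_pushed_path_variation_of_constants:
  assumes path: "ou_pushed_path \<alpha> \<gamma> x w y l" and w: "continuous_on {0..} w"
    and "\<gamma> \<noteq> 0" "0 \<le> \<tau>" "\<tau> \<le> T"
  shows "y T = exp (- \<gamma> * (T - \<tau>)) * y \<tau> + \<alpha> / \<gamma> * (1 - exp (- \<gamma> * (T - \<tau>))) +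
    exp_weighted_increment \<gamma> T w \<tau> + exp_weighted_increment \<gamma> T l \<tau>"
proof -
  have y: "continuous_on {0..} y" and l: "continuous_on {0..} l"
    and eq: "\<And>t. 0 \<le> t \<Longrightarrow> y t = x + (LINT s:{0..t}|lborel. \<alpha> - \<gamma> * y s) + w t + l t"
    using path by (auto simp: ou_pushed_path_def)
  have cont: "continuous_on {0..T} y" "continuous_on {\<tau>..T} w" "continuous_on {\<tau>..T} l"
    using y l w assms(4,5) by (auto elim!: continuous_on_subset)
  let ?h = "\<lambda>s. \<alpha> - \<gamma> * y s"
  let ?g = "\<lambda>s. exp (- \<gamma> * (T - s))"
  define z where "z = (\<lambda>t. x + integral {0..t} ?h)"
  have h: "continuous_on {0..T} ?h" using cont by (intro continuous_intros)
  have z: "z t = y t - (w t + l t)" if "t \<in> {0..T}" for t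
  proof -
    have "set_integrable lborel {0..t} ?h"
      using that by (intro borel_integrable_atLeastAtMost' continuous_on_subset[OF h]) auto
    then show ?thesis
      using eq[of t] that by (simp add: z_def set_borel_integral_eq_integral(2))
  qed
  have dz: "(z has_real_derivative ?h t) (at t within {\<tau>..T})" if "t \<in> {\<tau>..T}" for t
  proof -
    have "((\<lambda>u. integral {0..u} ?h) has_real_derivative ?h t) (at t within {0..T})"
      using that assms(4) by (intro integral_has_real_derivative h) auto
    then have "(z has_real_derivative ?h t) (at t within {0..T})"
      unfolding z_def by (auto intro!: derivative_eq_intros)
    then show ?thesis by (rule DERIV_subset) (use assms(4) in auto)
  qed
  \<comment> \<open>With the integrating factor the unknown \<open>y\<close> cancels from the
    derivative; what remains contains only the given paths \<open>w\<close> and \<open>l\<close> and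
    can be integrated.\<close>
  have "((\<lambda>t. ?g t * z t) has_real_derivative ?g t * \<alpha> - \<gamma> * ?g t * (w t + l t)) (at t within {\<tau>..T})"
    if "t \<in> {\<tau>..T}" for t
  proof -
    have "((\<lambda>t. ?g t * z t) has_real_derivative \<gamma> * ?g t * z t + ?h t * ?g t) (at t within {\<tau>..T})"
      using dz[OF that] by (auto intro!: derivative_eq_intros)
    moreover have "\<gamma> * ?g t * z t + ?h t * ?g t = ?g t * \<alpha> - \<gamma> * ?g t * (w t + l t)"
    proof -
      have "y t = z t + w t + l t" using z[of t] that assms(4) by simp
      then show ?thesis by (simp only: algebra_simps)
    qed
    ultimately show ?thesis by simp
  qed
  then have "((\<lambda>t. ?g t * \<alpha> - \<gamma> * ?g t * (w t + l t)) has_integral ?g T * z T - ?g \<tau> * z \<tau>) {\<tau>..T}"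
    using \<open>\<tau> \<le> T\<close>
    by (intro fundamental_theorem_of_calculus) (auto simp flip: has_real_derivative_iff_has_vector_derivative)
  moreover have "((\<lambda>t. ?g t * \<alpha> - \<gamma> * ?g t * (w t + l t)) has_integral
      (1 - ?g \<tau>) * (\<alpha> / \<gamma>) - (integral {\<tau>..T} (\<lambda>t. \<gamma> * ?g t * w t) + integral {\<tau>..T} (\<lambda>t. \<gamma> * ?g t * l t))) {\<tau>..T}"
  proof -
    have "((\<lambda>t. \<gamma> * ?g t * (\<alpha> / \<gamma>) - (\<gamma> * ?g t * w t + \<gamma> * ?g t * l t)) has_integral
        (?g T - ?g \<tau>) * (\<alpha> / \<gamma>) - (integral {\<tau>..T} (\<lambda>t. \<gamma> * ?g t * w t) + integral {\<tau>..T} (\<lambda>t. \<gamma> * ?g t * l t))) {\<tau>..T}"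
      by (intro has_integral_diff has_integral_add has_integral_mult_left integral_exp_weight \<open>\<tau> \<le> T\<close>
          integrable_integral integrable_continuous_real continuous_intros cont)
    then show ?thesis
      using \<open>\<gamma> \<noteq> 0\<close> by (simp add: algebra_simps del: mult_minus_left)
  qed
  ultimately have "?g T * z T - ?g \<tau> * z \<tau> = (1 - ?g \<tau>) * (\<alpha> / \<gamma>) -
      (integral {\<tau>..T} (\<lambda>t. \<gamma> * ?g t * w t) + integral {\<tau>..T} (\<lambda>t. \<gamma> * ?g t * l t))"
    by (rule has_integral_unique)
  then show ?thesis
    using z[of \<tau>] z[of T] assms(4,5)
    by (simp add: exp_weighted_increment_def algebra_simps del: mult_minus_left)
qed

lemma ou_pushed_path_0:
  assumes "ou_pushed_path \<alpha> \<gamma> x w y l" and "w 0 = 0"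
  shows "y 0 = x"
proof -
  have "y 0 = x + (LINT s:{0..0}|lborel. \<alpha> - \<gamma> * y s) + w 0 + l 0" "l 0 = 0"
    using assms(1) by (auto simp: ou_pushed_path_def)
  moreover have "(LINT s:{0..0}|lborel. \<alpha> - \<gamma> * y s) = 0"
    unfolding set_lebesgue_integral_def
    by (rule integral_eq_zero_AE, rule eventually_mono[OF AE_lborel_singleton[of 0]]) simp
  ultimately show ?thesis using assms(2) by simp
qed

text \<open>The increase of \<open>l\<close> is the Stieltjes mass of the half-open interval, which
  is at most the mass of \<open>{s. 0 < y s}\<close> within \<open>{0..t}\<close>, and that is zero.
  The left end is excluded because \<open>y\<close> may vanish at \<open>\<tau>\<close>.\<close>

lemma reflected_ou_path_const_of_pos:
  assumes "reflected_ou_path \<alpha> \<gamma> x w y l" and "0 \<le> \<tau>" "\<tau> < t"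
    and pos: "\<And>s. s \<in> {\<tau><..t} \<Longrightarrow> 0 < y s"
  shows "l t = l \<tau>"
proof -
  let ?F = "\<lambda>s. l (max 0 s)"
  have l: "continuous_on {0..} l" and mono: "mono_on {0..} l"
    and null: "(\<integral>\<^sup>+ s\<in>{0..t}. indicator {s. 0 < y s} s \<partial>interval_measure ?F) = 0"
    using assms(1-3) by (auto simp: reflected_ou_path_def ou_pushed_path_def)
  have mF: "?F u \<le> ?F v" if "u \<le> v" for u v
    using that by (intro mono_onD[OF mono]) auto
  have "continuous_on UNIV ?F"
    by (rule continuous_on_compose2[OF l]) (auto intro!: continuous_intros)
  then have "continuous (at_right u) ?F" for u
    by (auto simp: continuous_on_eq_continuous_at intro: continuous_at_imp_continuous_within)
  then have em: "emeasure (interval_measure ?F) {\<tau><..t} = ennreal (?F t - ?F \<tau>)"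
    using mF \<open>\<tau> < t\<close> by (intro emeasure_interval_measure_Ioc) auto
  have "emeasure (interval_measure ?F) {\<tau><..t} = (\<integral>\<^sup>+ s. indicator {\<tau><..t} s \<partial>interval_measure ?F)"
    by simp
  also have "\<dots> \<le> (\<integral>\<^sup>+ s\<in>{0..t}. indicator {s. 0 < y s} s \<partial>interval_measure ?F)"
    using pos \<open>0 \<le> \<tau>\<close> by (intro nn_integral_mono) (auto simp: indicator_def)
  finally have "?F t - ?F \<tau> \<le> 0"
    unfolding em null by (simp add: ennreal_eq_0_iff)
  moreover have "l \<tau> \<le> l t" using assms(2,3) by (intro mono_onD[OF mono]) auto
  ultimately show ?thesis using assms(2,3) by simp
qed

text \<open>Comparison with the unreflected process: variation of constants from time 0, with the
  nonnegative contribution of the regulator dropped.\<close>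

lemma ou_pushed_path_lower_bound:
  assumes path: "ou_pushed_path \<alpha> \<gamma> x w y l" and w: "continuous_on {0..} w" "w 0 = 0"
    and "0 < \<gamma>" "0 \<le> T"
  shows "ou_mean \<alpha> \<gamma> x T + exp_weighted_increment \<gamma> T w 0 \<le> y T"
proof -
  have "y 0 = x"
    using ou_pushed_path_0[OF path w(2)] .
  moreover have "0 \<le> exp_weighted_increment \<gamma> T l 0"
  proof -
    have l: "mono_on {0..T} l" "continuous_on {0..T} l" "l 0 = 0"
      using path by (auto simp: ou_pushed_path_def intro: mono_on_subset continuous_on_subset)
    then have "0 \<le> exp (- \<gamma> * (T - 0)) * (l T - l 0)" "exp (- \<gamma> * (T - 0)) * (l T - l 0) \<le> exp_weighted_increment \<gamma> T l 0"
      using exp_weighted_increment_mono[of \<gamma> 0 T l] assms by auto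
    then show ?thesis by linarith
  qed
  ultimately show ?thesis
    using ou_pushed_path_variation_of_constants[OF path w(1), of 0 T] assms
    by (simp add: ou_mean_def algebra_simps)
qed

text \<open>After its last zero \<open>\<tau>\<close> the path is not pushed any more; if there is no zero, take \<open>\<tau> = 0\<close>.\<close>
lemma reflected_ou_path_upper_bound:
  assumes path: "reflected_ou_path \<alpha> \<gamma> x w y l" and w: "continuous_on {0..} w" "w 0 = 0"
    and "0 < \<alpha>" "0 < \<gamma>" "0 \<le> T" "0 \<le> x" and b: "0 < y T"
  obtains \<tau> where "\<tau> \<in> {0..T}" "y T \<le> ou_mean \<alpha> \<gamma> x T + exp_weighted_increment \<gamma> T w \<tau>"
proof -
  have pp: "ou_pushed_path \<alpha> \<gamma> x w y l"
    using path by (simp add: reflected_ou_path_def)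
  then have y: "continuous_on {0..} y" and ynn: "\<And>t. 0 \<le> t \<Longrightarrow> 0 \<le> y t"
    and l: "continuous_on {0..} l"
    by (auto simp: ou_pushed_path_def)
  have y0: "y 0 = x"
    using ou_pushed_path_0[OF pp w(2)] .
  let ?Z = "{t \<in> {0..T}. y t = 0}"
  obtain \<tau> where \<tau>: "0 \<le> \<tau>" "\<tau> \<le> T" "y \<tau> = 0 \<or> \<tau> = 0" "\<And>s. s \<in> {\<tau><..T} \<Longrightarrow> 0 < y s"
  proof (cases "?Z = {}")
    case True
    then have "0 < y s" if "s \<in> {0<..T}" for s
      using that ynn[of s] by (auto simp: less_le)
    then show ?thesis using that[of 0] \<open>0 \<le> T\<close> by auto
  next
    case False
    \<comment> \<open>Compactness of the zero set provides a last zero.\<close>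
    have "compact ?Z"
    proof -
      have "closed ({0..T} \<inter> y -` {0})"
        by (rule continuous_closed_preimage[OF continuous_on_subset[OF y]]) auto
      moreover have "?Z = {0..T} \<inter> y -` {0}" by auto
      moreover have "bounded ?Z" by (rule bounded_subset[of "{0..T}"]) auto
      ultimately show ?thesis by (simp add: compact_eq_bounded_closed)
    qed
    then obtain \<tau> where Z: "\<tau> \<in> ?Z" and max: "\<And>s. s \<in> ?Z \<Longrightarrow> s \<le> \<tau>"
      using compact_attains_sup[OF _ False] by blast
    have pos: "0 < y s" if "s \<in> {\<tau><..T}" for s
    proof -
      have "0 \<le> s" using Z that by simp
      moreover have "s \<notin> ?Z" using max[of s] that by fastforce
      ultimately show ?thesis using ynn[of s] that by (simp add: less_le)
    qed
    show ?thesis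
      by (rule that[OF _ _ _ pos]) (use Z in simp_all)
  qed
  have "l s = l \<tau>" if "s \<in> {\<tau>..T}" for s
    using reflected_ou_path_const_of_pos[OF path \<tau>(1), of s] \<tau>(4) that
    by (cases "s = \<tau>") auto
  then have "exp_weighted_increment \<gamma> T l \<tau> = 0"
    by (rule exp_weighted_increment_const[OF \<tau>(2)])
  then have eq: "y T = exp (- \<gamma> * (T - \<tau>)) * y \<tau> + \<alpha> / \<gamma> * (1 - exp (- \<gamma> * (T - \<tau>))) +
      exp_weighted_increment \<gamma> T w \<tau>"
    using ou_pushed_path_variation_of_constants[OF pp w(1) _ \<tau>(1,2)] assms by simp
  \<comment> \<open>A restart from 0 at a later time has less time to relax towards
    \<open>\<alpha> / \<gamma>\<close> and loses the nonnegative contribution of \<open>x\<close>,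
    so its mean at \<open>T\<close> cannot exceed that of the start at \<open>x\<close>.\<close>
  have "exp (- \<gamma> * (T - \<tau>)) * y \<tau> + \<alpha> / \<gamma> * (1 - exp (- \<gamma> * (T - \<tau>))) \<le> ou_mean \<alpha> \<gamma> x T"
  proof (cases "\<tau> = 0")
    case True
    then show ?thesis by (simp add: y0 ou_mean_def algebra_simps)
  next
    case False
    have "ou_mean \<alpha> \<gamma> x T = exp (- \<gamma> * T) * x + \<alpha> / \<gamma> * (1 - exp (- \<gamma> * T))"
      by (simp add: ou_mean_def algebra_simps)
    moreover have "\<alpha> / \<gamma> * (1 - exp (- \<gamma> * (T - \<tau>))) \<le> \<alpha> / \<gamma> * (1 - exp (- \<gamma> * T))"
      using assms \<tau>(1) by (intro mult_left_mono) (auto simp: algebra_simps)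
    moreover have "0 \<le> exp (- \<gamma> * T) * x" using \<open>0 \<le> x\<close> by simp
    ultimately show ?thesis using False \<tau>(3) by simp
  qed
  with eq \<tau>(1,2) that[of \<tau>] show ?thesis by auto
qed

section \<open>Riemann sums of the Wiener integral\<close>

text \<open>Left-point sums on the grid of mesh \<open>T / n\<close>. The lower index varies and the
  upper one is fixed, since the last zero of the path enters as the lower limit of the Wiener
  integral.\<close>

definition exp_weighted_sum :: "real \<Rightarrow> real \<Rightarrow> nat \<Rightarrow> (real \<Rightarrow> real) \<Rightarrow> nat \<Rightarrow> real" where
  "exp_weighted_sum \<gamma> T n w k = (\<Sum>i=k..<n. exp (- \<gamma> * (T - real i * T / real n)) *
     (w (real (Suc i) * T / real n) - w (real i * T / real n)))"

lemma exp_weighted_increment_split: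
  assumes "continuous_on {0..T} w" "0 \<le> s" "s \<le> t" "t \<le> T"
  shows "exp_weighted_increment \<gamma> T w s - exp_weighted_increment \<gamma> T w t =
    exp (- \<gamma> * (T - t)) * w t - exp (- \<gamma> * (T - s)) * w s -
    integral {s..t} (\<lambda>r. \<gamma> * exp (- \<gamma> * (T - r)) * w r)"
proof -
  have "integral {s..t} (\<lambda>r. \<gamma> * exp (- \<gamma> * (T - r)) * w r) +
      integral {t..T} (\<lambda>r. \<gamma> * exp (- \<gamma> * (T - r)) * w r) =
      integral {s..T} (\<lambda>r. \<gamma> * exp (- \<gamma> * (T - r)) * w r)"
    using assms
    by (intro Henstock_Kurzweil_Integration.integral_combine integrable_continuous_real
        continuous_intros continuous_on_subset[OF assms(1)]) auto
  then show ?thesis by (simp add: exp_weighted_increment_def)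
qed

text \<open>The difference of the weights is the integral of the positive kernel
  \<open>\<gamma> * exp (- \<gamma> * (T - r))\<close>, so the quantity estimated is the integral of
  this kernel against \<open>w t - w r\<close>.\<close>

lemma exp_weighted_step_bound:
  fixes w :: "real \<Rightarrow> real"
  assumes w: "continuous_on {s..t} w" and "s \<le> t" "0 < \<gamma>"
    and \<omega>: "\<And>r. r \<in> {s..t} \<Longrightarrow> \<bar>w t - w r\<bar> \<le> \<omega>"
  shows "\<bar>(exp (- \<gamma> * (T - t)) - exp (- \<gamma> * (T - s))) * w t -
    integral {s..t} (\<lambda>r. \<gamma> * exp (- \<gamma> * (T - r)) * w r)\<bar> \<le>
    \<omega> * (exp (- \<gamma> * (T - t)) - exp (- \<gamma> * (T - s)))"
proof -
  let ?k = "\<lambda>r. \<gamma> * exp (- \<gamma> * (T - r))"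
  have I: "((\<lambda>r. ?k r * c) has_integral (exp (- \<gamma> * (T - t)) - exp (- \<gamma> * (T - s))) * c) {s..t}" for c
    using has_integral_mult_left[OF integral_exp_weight[OF \<open>s \<le> t\<close>]] .
  have J: "((\<lambda>r. ?k r * w t - ?k r * w r) has_integral
      (exp (- \<gamma> * (T - t)) - exp (- \<gamma> * (T - s))) * w t - integral {s..t} (\<lambda>r. ?k r * w r)) {s..t}"
    by (intro has_integral_diff I integrable_integral integrable_continuous_real continuous_intros w)
  have "norm (integral {s..t} (\<lambda>r. ?k r * w t - ?k r * w r)) \<le> integral {s..t} (\<lambda>r. ?k r * \<omega>)"
  proof (rule integral_norm_bound_integral)
    show "(\<lambda>r. ?k r * w t - ?k r * w r) integrable_on {s..t}" "(\<lambda>r. ?k r * \<omega>) integrable_on {s..t}"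
      using I J by (auto simp: integrable_on_def)
    fix r assume "r \<in> {s..t}"
    then have "?k r * \<bar>w t - w r\<bar> \<le> ?k r * \<omega>"
      using \<omega> \<open>0 < \<gamma>\<close> by (intro mult_left_mono) auto
    then show "norm (?k r * w t - ?k r * w r) \<le> ?k r * \<omega>"
      using \<open>0 < \<gamma>\<close> by (simp add: abs_mult flip: right_diff_distrib)
  qed
  then show ?thesis
    unfolding integral_unique[OF J] integral_unique[OF I] real_norm_def by (simp only: mult.commute[of \<omega>])
qed

text \<open>The error is accumulated cell by cell, backwards from \<open>T\<close>. The cell bounds
  telescope, so the total stays below \<open>\<omega>\<close> however many cells there are.\<close>

lemma exp_weighted_sum_error:
  assumes w: "continuous_on {0..T} w" and "0 < \<gamma>" "0 < T" "0 < n" "k \<le> n"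
    and \<omega>: "\<And>r s. r \<in> {0..T} \<Longrightarrow> s \<in> {0..T} \<Longrightarrow> \<bar>s - r\<bar> \<le> T / real n \<Longrightarrow> \<bar>w s - w r\<bar> \<le> \<omega>"
  shows "\<bar>exp_weighted_increment \<gamma> T w (real k * T / real n) - exp_weighted_sum \<gamma> T n w k\<bar> \<le>
    \<omega> * (1 - exp (- \<gamma> * (T - real k * T / real n)))"
  using \<open>k \<le> n\<close>
proof (induction k rule: inc_induct)
  case base
  have "exp_weighted_increment \<gamma> T w T = 0"
    by (simp add: exp_weighted_increment_def)
  then show ?case
    using \<open>0 < n\<close> by (simp add: exp_weighted_sum_def)
next
  case (step k)
  let ?s = "real k * T / real n" and ?t = "real (Suc k) * T / real n"
  let ?g = "\<lambda>r. exp (- \<gamma> * (T - r))"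
  have k: "real (Suc k) \<le> real n" using step by simp
  have st: "0 \<le> ?s" "?s \<le> ?t" "?t \<le> T" "?t - ?s = T / real n"
    using \<open>0 < T\<close> \<open>0 < n\<close> k mult_right_mono[OF k, of T] by (auto simp: field_simps)
  have "exp_weighted_sum \<gamma> T n w k = ?g ?s * (w ?t - w ?s) + exp_weighted_sum \<gamma> T n w (Suc k)"
    using step by (simp add: exp_weighted_sum_def sum.atLeast_Suc_lessThan)
  \<comment> \<open>Since the sum puts the left-point weight on the increment, \<open>w ?s\<close>
    cancels and exactly the expression of \<open>exp_weighted_step_bound\<close> remains.\<close>
  then have "exp_weighted_increment \<gamma> T w ?s - exp_weighted_sum \<gamma> T n w k =
      (exp_weighted_increment \<gamma> T w ?t - exp_weighted_sum \<gamma> T n w (Suc k)) +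
      ((?g ?t - ?g ?s) * w ?t - integral {?s..?t} (\<lambda>r. \<gamma> * ?g r * w r))"
    using exp_weighted_increment_split[OF w st(1-3), of \<gamma>] by (simp only: algebra_simps)
  moreover have "\<bar>(?g ?t - ?g ?s) * w ?t - integral {?s..?t} (\<lambda>r. \<gamma> * ?g r * w r)\<bar> \<le> \<omega> * (?g ?t - ?g ?s)"
  proof (rule exp_weighted_step_bound)
    show "continuous_on {?s..?t} w" by (rule continuous_on_subset[OF w]) (use st in auto)
    show "\<bar>w ?t - w r\<bar> \<le> \<omega>" if "r \<in> {?s..?t}" for r
    proof (rule \<omega>)
      show "r \<in> {0..T}" "?t \<in> {0..T}" using that st by auto
      show "\<bar>?t - r\<bar> \<le> T / real n" using that st(4) by (simp only: atLeastAtMost_iff) linarith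
    qed
  qed (use st \<open>0 < \<gamma>\<close> in auto)
  ultimately show ?case
    using step.IH by (simp only: right_diff_distrib)
qed

lemma uniform_modulus_eventually:
  fixes w :: "real \<Rightarrow> real"
  assumes w: "continuous_on {0..T} w" and "0 < \<omega>"
  shows "\<forall>\<^sub>F n in sequentially. \<forall>r\<in>{0..T}. \<forall>s\<in>{0..T}. \<bar>s - r\<bar> \<le> T / real n \<longrightarrow> \<bar>w s - w r\<bar> \<le> \<omega>"
proof -
  have "uniformly_continuous_on {0..T} w"
    by (rule compact_uniformly_continuous[OF w]) simp
  then obtain d where d: "d > 0" "\<And>r s. r \<in> {0..T} \<Longrightarrow> s \<in> {0..T} \<Longrightarrow> dist s r < d \<Longrightarrow> dist (w s) (w r) < \<omega>"
    using \<open>0 < \<omega>\<close> unfolding uniformly_continuous_on_def by metis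
  have "(\<lambda>n. T / real n) \<longlonglongrightarrow> 0" by (rule lim_const_over_n)
  then have "\<forall>\<^sub>F n in sequentially. T / real n < d"
    using d(1) by (rule order_tendstoD)
  then show ?thesis
    by eventually_elim (use d(2) in \<open>force simp: dist_real_def\<close>)
qed

lemma exp_weighted_sum_tendsto:
  assumes w: "continuous_on {0..T} w" and "0 < \<gamma>" "0 < T"
  shows "(\<lambda>n. exp_weighted_sum \<gamma> T n w 0) \<longlonglongrightarrow> exp_weighted_increment \<gamma> T w 0"
proof (rule tendstoI)
  fix e :: real assume "0 < e"
  then have "0 < e / 2" by simp
  from uniform_modulus_eventually[OF w this] eventually_gt_at_top[of 0]
  show "\<forall>\<^sub>F n in sequentially. dist (exp_weighted_sum \<gamma> T n w 0) (exp_weighted_increment \<gamma> T w 0) < e"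
  proof eventually_elim
    case (elim n)
    have "\<bar>exp_weighted_increment \<gamma> T w 0 - exp_weighted_sum \<gamma> T n w 0\<bar> \<le> e / 2 * (1 - exp (- \<gamma> * T))"
      using exp_weighted_sum_error[OF w assms(2,3) elim(2), of 0 "e / 2"] elim by simp
    also have "\<dots> \<le> e / 2 * 1" using \<open>0 < e\<close> by (intro mult_left_mono) auto
    also have "\<dots> < e" using \<open>0 < e\<close> by simp
    finally show ?case by (simp add: dist_real_def abs_minus_commute)
  qed
qed

lemma exp_weighted_sum_eventually_exceeds:
  assumes w: "continuous_on {0..T} w" and "0 < \<gamma>" "0 < T"
    and \<tau>: "\<tau> \<in> {0..T}" and a: "a < exp_weighted_increment \<gamma> T w \<tau>"
  shows "\<forall>\<^sub>F n in sequentially. \<exists>k\<le>n. a \<le> exp_weighted_sum \<gamma> T n w k"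
proof -
  let ?W = "exp_weighted_increment \<gamma> T w"
  \<comment> \<open>Half of the gap pays for moving \<open>\<tau>\<close> to a grid point, the other
    half for the Riemann sum error there.\<close>
  define e where "e = (?W \<tau> - a) / 2"
  have e: "0 < e" using a by (simp add: e_def)
  have "continuous_on {0..T} ?W"
    unfolding exp_weighted_increment_def[abs_def]
    by (intro continuous_intros w indefinite_integral_continuous_1' integrable_continuous_real)
  then obtain d where d: "d > 0" "\<And>s. s \<in> {0..T} \<Longrightarrow> \<bar>s - \<tau>\<bar> < d \<Longrightarrow> \<bar>?W s - ?W \<tau>\<bar> < e"
    using \<tau> e unfolding continuous_on_iff dist_real_def by metis
  have "(\<lambda>n. T / real n) \<longlonglongrightarrow> 0" by (rule lim_const_over_n)
  then have "\<forall>\<^sub>F n in sequentially. T / real n < d"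
    using d(1) by (rule order_tendstoD)
  with uniform_modulus_eventually[OF w e] eventually_gt_at_top[of 0]
  show ?thesis
  proof eventually_elim
    case (elim n)
    \<comment> \<open>The index of the last grid point not after \<open>\<tau>\<close>.\<close>
    define k where "k = nat \<lfloor>\<tau> * real n / T\<rfloor>"
    have k0: "real k = of_int \<lfloor>\<tau> * real n / T\<rfloor>"
      using \<tau> \<open>0 < T\<close> by (simp add: k_def)
    have k1: "real k \<le> \<tau> * real n / T" "\<tau> * real n / T < real k + 1"
      unfolding k0 by linarith+
    have "\<tau> * real n / T \<le> real n"
      using \<tau> \<open>0 < T\<close> by (simp add: field_simps mult_right_mono)
    then have kn: "k \<le> n" using k1(1) by linarith
    let ?s = "real k * T / real n"
    have s: "?s \<le> \<tau>" "\<tau> < ?s + T / real n" "0 \<le> ?s"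
      using k1 \<open>0 < T\<close> elim(2) by (auto simp: field_simps)
    have "\<bar>?W ?s - ?W \<tau>\<bar> < e"
      by (rule d(2)) (use s \<tau> elim(3) in auto)
    moreover have "\<bar>?W ?s - exp_weighted_sum \<gamma> T n w k\<bar> \<le> e * (1 - exp (- \<gamma> * (T - ?s)))"
      using exp_weighted_sum_error[OF w assms(2,3) elim(2) kn, of e] elim by simp
    moreover have "e * (1 - exp (- \<gamma> * (T - ?s))) \<le> e * 1"
      using e by (intro mult_left_mono) auto
    ultimately have "a \<le> exp_weighted_sum \<gamma> T n w k"
      using e_def by argo
    then show ?case using kn by blast
  qed
qed

section \<open>Exponential maximal inequality and Gaussian estimates\<close>

text \<open>Conditioning on the last summand turns the bound for \<open>n\<close> at the level \<open>a - X n\<close> into the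
  bound for \<open>Suc n\<close> at the level \<open>a\<close>.\<close>
lemma (in prob_space) emeasure_tail_sum_le:
  fixes X :: "nat \<Rightarrow> 'a \<Rightarrow> real"
  assumes "indep_vars (\<lambda>_. borel) X {..<n}" and "0 \<le> \<theta>"
    and "\<And>i. i < n \<Longrightarrow> (\<integral>\<^sup>+\<omega>. ennreal (exp (\<theta> * X i \<omega>)) \<partial>M) \<le> ennreal (m i)"
    and "\<And>i. i < n \<Longrightarrow> 1 \<le> m i"
  shows "emeasure M {\<omega> \<in> space M. \<exists>k\<le>n. a \<le> (\<Sum>i=k..<n. X i \<omega>)} \<le>
    ennreal (exp (- \<theta> * a) * (\<Prod>i<n. m i))"
  using assms
proof (induction n arbitrary: a)
  case 0
  \<comment> \<open>Only the empty sum is available: the event is certain or void according to the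
    sign of \<open>a\<close>, and where it is certain the bound is at least 1.\<close>
  show ?case
  proof (cases "a \<le> 0")
    case True
    have "emeasure M {\<omega> \<in> space M. \<exists>k\<le>0. a \<le> (\<Sum>i=k..<0. X i \<omega>)} \<le> 1"
      by (rule emeasure_le_1)
    also have "1 \<le> ennreal (exp (- \<theta> * a))"
      using True 0 by (simp add: mult_nonneg_nonpos)
    finally show ?thesis by simp
  qed simp
next
  case (Suc n)
  have m: "0 \<le> (\<Prod>i<n. m i)" "1 \<le> (\<Prod>i<Suc n. m i)"
  proof -
    show "1 \<le> (\<Prod>i<Suc n. m i)" using Suc.prems(4) by (intro prod_ge_1) auto
    show "0 \<le> (\<Prod>i<n. m i)" using Suc.prems(4) by (intro prod_nonneg) (auto intro: order_trans[of 0 1])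
  qed
  \<comment> \<open>The empty sum at \<open>k = Suc n\<close> reaches the level when
    \<open>a \<le> 0\<close>, and then the bound is trivial because all \<open>m i\<close> are at
    least 1. For positive \<open>a\<close> it does not, so every relevant tail sum contains
    \<open>X n\<close>, which can be split off.\<close>
  show ?case
  proof (cases "a \<le> 0")
    case True
    have "emeasure M {\<omega> \<in> space M. \<exists>k\<le>Suc n. a \<le> (\<Sum>i=k..<Suc n. X i \<omega>)} \<le> 1"
      by (rule emeasure_le_1)
    also have "1 \<le> exp (- \<theta> * a) * (\<Prod>i<Suc n. m i)"
      using True Suc.prems(2) m(2) mult_mono[of 1 "exp (- \<theta> * a)" 1 "\<Prod>i<Suc n. m i"]
      by (simp add: mult_nonneg_nonpos)
    then have "1 \<le> ennreal (exp (- \<theta> * a) * (\<Prod>i<Suc n. m i))"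
      by (metis ennreal_1 ennreal_leI)
    finally show ?thesis .
  next
    case False
    let ?P = "PiM {..<n} (\<lambda>_. borel :: real measure)"
    let ?Q = "PiM {n} (\<lambda>_. borel :: real measure)"
    let ?U = "\<lambda>\<omega>. \<lambda>i\<in>{n}. X i \<omega>"
    let ?V = "\<lambda>\<omega>. \<lambda>i\<in>{..<n}. X i \<omega>"
    have X: "random_variable borel (X i)" if "i < Suc n" for i
      using Suc.prems(1) that by (auto simp: indep_vars_def)
    \<comment> \<open>The last variable and the earlier ones form independent blocks, so their joint
      law is a product and the event can be sliced at a fixed value of \<open>X n\<close>.\<close>
    have "indep_var ?Q ?U ?P ?V"
      by (intro indep_var_restrict[OF Suc.prems(1)]) auto
    then have joint: "distr M ?Q ?U \<Otimes>\<^sub>M distr M ?P ?V = distr M (?Q \<Otimes>\<^sub>M ?P) (\<lambda>\<omega>. (?U \<omega>, ?V \<omega>))"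
      and U: "random_variable ?Q ?U" and V: "random_variable ?P ?V"
      by (auto simp: indep_var_distribution_eq)
    have [measurable]: "random_variable borel (X n)" by (rule X) simp
    note U[measurable] V[measurable]
    define E where "E = {p \<in> space (?Q \<Otimes>\<^sub>M ?P). \<exists>k\<le>n. a - fst p n \<le> (\<Sum>i=k..<n. snd p i)}"
    have E: "E \<in> sets (?Q \<Otimes>\<^sub>M ?P)"
    proof -
      have "E = {p \<in> space (?Q \<Otimes>\<^sub>M ?P). \<exists>k\<in>{..n}. a - fst p n \<le> (\<Sum>i=k..<n. snd p i)}"
        by (auto simp: E_def)
      also have "\<dots> \<in> sets (?Q \<Otimes>\<^sub>M ?P)"
      proof (rule sets.sets_Collect_finite_Ex)
      fix k assume "k \<in> {..n}"
      have "(\<lambda>p. \<Sum>i=k..<n. snd p i) \<in> borel_measurable (?Q \<Otimes>\<^sub>M ?P)"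
        by (intro borel_measurable_sum measurable_compose[OF measurable_snd] measurable_component_singleton) auto
      moreover have "(\<lambda>p. a - fst p n) \<in> borel_measurable (?Q \<Otimes>\<^sub>M ?P)"
        by (intro borel_measurable_diff measurable_compose[OF measurable_fst] measurable_component_singleton) auto
      ultimately show "{p \<in> space (?Q \<Otimes>\<^sub>M ?P). a - fst p n \<le> (\<Sum>i=k..<n. snd p i)} \<in> sets (?Q \<Otimes>\<^sub>M ?P)"
        by measurable
      qed simp
      finally show ?thesis .
    qed
    have "{\<omega> \<in> space M. \<exists>k\<le>Suc n. a \<le> (\<Sum>i=k..<Suc n. X i \<omega>)} =
      (\<lambda>\<omega>. (?U \<omega>, ?V \<omega>)) -` E \<inter> space M"
    proof -
      have "a \<le> (\<Sum>i=k..<Suc n. X i \<omega>) \<longleftrightarrow> a - ?U \<omega> n \<le> (\<Sum>i=k..<n. ?V \<omega> i)" if "k \<le> n" for k \<omega>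
        using that by (simp add: sum.atLeastLessThan_Suc) linarith
      then have "(\<exists>k\<le>Suc n. a \<le> (\<Sum>i=k..<Suc n. X i \<omega>)) \<longleftrightarrow>
          (\<exists>k\<le>n. a - ?U \<omega> n \<le> (\<Sum>i=k..<n. ?V \<omega> i))" for \<omega>
        using False by (metis atLeastLessThan_empty le_SucE le_SucI order_refl sum.empty)
      then show ?thesis
        by (auto simp: E_def space_pair_measure space_PiM)
    qed
    then have "emeasure M {\<omega> \<in> space M. \<exists>k\<le>Suc n. a \<le> (\<Sum>i=k..<Suc n. X i \<omega>)} =
        emeasure (distr M ?Q ?U \<Otimes>\<^sub>M distr M ?P ?V) E"
      unfolding joint using E by (subst emeasure_distr) auto
    also have "\<dots> = (\<integral>\<^sup>+u. emeasure (distr M ?P ?V) (Pair u -` E) \<partial>distr M ?Q ?U)"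
    proof -
      interpret V: prob_space "distr M ?P ?V" by (rule prob_space_distr[OF V])
      have "E \<in> sets (distr M ?Q ?U \<Otimes>\<^sub>M distr M ?P ?V)"
        using E by (simp cong: sets_pair_measure_cong)
      then show ?thesis by (rule V.emeasure_pair_measure_alt)
    qed
    also have "\<dots> \<le> (\<integral>\<^sup>+u. ennreal (exp (- \<theta> * (a - u n)) * (\<Prod>i<n. m i)) \<partial>distr M ?Q ?U)"
    proof (rule nn_integral_mono)
      fix u assume "u \<in> space (distr M ?Q ?U)"
      then have u: "u \<in> space ?Q" by simp
      have "?V -` (Pair u -` E) \<inter> space M = {\<omega> \<in> space M. \<exists>k\<le>n. a - u n \<le> (\<Sum>i=k..<n. X i \<omega>)}"
      proof -
        have "(\<Sum>i=k..<n. ?V \<omega> i) = (\<Sum>i=k..<n. X i \<omega>)" for k \<omega>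
          by (intro sum.cong) auto
        then have "(u, ?V \<omega>) \<in> E \<longleftrightarrow> (\<exists>k\<le>n. a - u n \<le> (\<Sum>i=k..<n. X i \<omega>))" for \<omega>
          using u by (simp add: E_def space_pair_measure space_PiM)
        then show ?thesis by (simp add: vimage_def Int_def conj_commute)
      qed
      then have "emeasure (distr M ?P ?V) (Pair u -` E) =
          emeasure M {\<omega> \<in> space M. \<exists>k\<le>n. a - u n \<le> (\<Sum>i=k..<n. X i \<omega>)}"
        using sets_Pair1[OF E] by (subst emeasure_distr) auto
      also have "\<dots> \<le> ennreal (exp (- \<theta> * (a - u n)) * (\<Prod>i<n. m i))"
        by (rule Suc.IH) (use Suc.prems in \<open>auto intro: indep_vars_subset\<close>)
      finally show "emeasure (distr M ?P ?V) (Pair u -` E) \<le> ennreal (exp (- \<theta> * (a - u n)) * (\<Prod>i<n. m i))" .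
    qed
    \<comment> \<open>Shifting the level by \<open>X n\<close> releases the factor
      \<open>exp (\<theta> * X n \<omega>)\<close>, whose mean is at most
      \<open>m n\<close>.\<close>
    also have "\<dots> = (\<integral>\<^sup>+\<omega>. ennreal (exp (- \<theta> * a) * (\<Prod>i<n. m i)) * ennreal (exp (\<theta> * X n \<omega>)) \<partial>M)"
      using m(1) by (subst nn_integral_distr)
        (auto simp: algebra_simps exp_add exp_diff exp_minus divide_inverse simp flip: ennreal_mult' intro!: nn_integral_cong)
    also have "\<dots> = ennreal (exp (- \<theta> * a) * (\<Prod>i<n. m i)) * (\<integral>\<^sup>+\<omega>. ennreal (exp (\<theta> * X n \<omega>)) \<partial>M)"
      by (intro nn_integral_cmult) auto
    also have "\<dots> \<le> ennreal (exp (- \<theta> * a) * (\<Prod>i<n. m i)) * ennreal (m n)"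
      using Suc.prems(3) by (intro mult_left_mono) auto
    also have "\<dots> = ennreal (exp (- \<theta> * a) * (\<Prod>i<Suc n. m i))"
      using m(1) by (simp add: mult.assoc flip: ennreal_mult')
    finally show ?thesis .
  qed
qed

text \<open>Completing the square: the exponential tilt moves the mean to
  \<open>\<theta> * s\<^sup>2\<close>, and the shifted density still has mass 1.\<close>

lemma normal_distributed_exp_moment:
  assumes X: "distributed M lborel X (normal_density 0 s)" and "0 < s"
  shows "(\<integral>\<^sup>+\<omega>. ennreal (exp (\<theta> * X \<omega>)) \<partial>M) = ennreal (exp (\<theta>\<^sup>2 * s\<^sup>2 / 2))"
proof -
  have "(\<integral>\<^sup>+\<omega>. ennreal (exp (\<theta> * X \<omega>)) \<partial>M) =
      (\<integral>\<^sup>+u. ennreal (normal_density 0 s u) * ennreal (exp (\<theta> * u)) \<partial>lborel)"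
    by (rule distributed_nn_integral[OF X, symmetric]) simp
  also have "\<dots> = (\<integral>\<^sup>+u. ennreal (exp (\<theta>\<^sup>2 * s\<^sup>2 / 2)) * ennreal (normal_density (\<theta> * s\<^sup>2) s u) \<partial>lborel)"
  proof (rule nn_integral_cong)
    fix u
    have "- (u - 0)\<^sup>2 / (2 * s\<^sup>2) + \<theta> * u = \<theta>\<^sup>2 * s\<^sup>2 / 2 + - (u - \<theta> * s\<^sup>2)\<^sup>2 / (2 * s\<^sup>2)"
      using \<open>0 < s\<close> by (simp add: field_simps power2_eq_square)
    then have "normal_density 0 s u * exp (\<theta> * u) = exp (\<theta>\<^sup>2 * s\<^sup>2 / 2) * normal_density (\<theta> * s\<^sup>2) s u"
      unfolding normal_density_def by (simp add: exp_add[symmetric] mult_ac)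
    then show "ennreal (normal_density 0 s u) * ennreal (exp (\<theta> * u)) =
        ennreal (exp (\<theta>\<^sup>2 * s\<^sup>2 / 2)) * ennreal (normal_density (\<theta> * s\<^sup>2) s u)"
      by (simp flip: ennreal_mult')
  qed
  also have "\<dots> = ennreal (exp (\<theta>\<^sup>2 * s\<^sup>2 / 2)) * (\<integral>\<^sup>+u. ennreal (normal_density (\<theta> * s\<^sup>2) s u) \<partial>lborel)"
    by (rule nn_integral_cmult) simp
  also have "(\<integral>\<^sup>+u. ennreal (normal_density (\<theta> * s\<^sup>2) s u) \<partial>lborel) = 1"
    using \<open>0 < s\<close> nn_integral_eq_integral[of lborel "normal_density (\<theta> * s\<^sup>2) s"]
    by (simp add: integral_normal_density)
  finally show ?thesis by simp
qed

text \<open>On the unit interval \<open>{a..a + 1}\<close> the density is at least its value at the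
  right end. This crude bound loses nothing on the logarithmic scale as \<open>a\<close>
  grows.\<close>

lemma (in prob_space) normal_tail_ge:
  assumes X: "distributed M lborel X (normal_density 0 s)" and "0 < s" and "0 \<le> a"
  shows "exp (- (a + 1)\<^sup>2 / (2 * s\<^sup>2)) / sqrt (2 * pi * s\<^sup>2) \<le> prob {\<omega> \<in> space M. a \<le> X \<omega>}"
proof -
  let ?c = "exp (- (a + 1)\<^sup>2 / (2 * s\<^sup>2)) / sqrt (2 * pi * s\<^sup>2)"
  have [measurable]: "random_variable borel X" using distributed_measurable[OF X] by simp
  have "ennreal ?c = (\<integral>\<^sup>+u. ennreal ?c * indicator {a..a + 1} u \<partial>lborel)"
    by (subst nn_integral_cmult_indicator) auto
  also have "\<dots> \<le> (\<integral>\<^sup>+u. ennreal (normal_density 0 s u) * indicator {a..} u \<partial>lborel)"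
  proof (rule nn_integral_mono)
    fix u
    have "?c \<le> normal_density 0 s u" if "u \<in> {a..a + 1}"
    proof -
      have "u\<^sup>2 \<le> (a + 1)\<^sup>2" using that \<open>0 \<le> a\<close> by (intro power_mono) auto
      then have "exp (- (a + 1)\<^sup>2 / (2 * s\<^sup>2)) \<le> exp (- u\<^sup>2 / (2 * s\<^sup>2))"
        using \<open>0 < s\<close> by (simp add: divide_right_mono)
      then show ?thesis by (simp add: normal_density_def divide_right_mono)
    qed
    then show "ennreal ?c * indicator {a..a + 1} u \<le> ennreal (normal_density 0 s u) * indicator {a..} u"
      by (auto simp: indicator_def intro: ennreal_leI)
  qed
  also have "\<dots> = emeasure M (X -` {a..} \<inter> space M)"
    by (rule distributed_emeasure[OF X, symmetric]) simp
  also have "X -` {a..} \<inter> space M = {\<omega> \<in> space M. a \<le> X \<omega>}" by auto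
  finally show ?thesis by (simp add: emeasure_eq_measure)
qed

text \<open>Fatou's lemma for the indicators of \<open>E n\<close>. It suits pathwise approximation,
  where the index from which a path lies in \<open>E n\<close> depends on the path. The bounds
  \<open>C n\<close> may vary, as do the variances of the Riemann sums.\<close>

lemma (in prob_space) prob_le_lim_of_eventually:
  assumes A: "A \<in> events" and E: "\<And>n. E n \<in> events"
    and AE: "AE \<omega> in M. \<omega> \<in> A \<longrightarrow> (\<forall>\<^sub>F n in sequentially. \<omega> \<in> E n)"
    and le: "\<forall>\<^sub>F n in sequentially. prob (E n) \<le> C n" and C: "C \<longlonglongrightarrow> c"
  shows "prob A \<le> c"
proof -
  have "emeasure M A = (\<integral>\<^sup>+\<omega>. indicator A \<omega> \<partial>M)"
    using A by simp
  also have "\<dots> \<le> (\<integral>\<^sup>+\<omega>. liminf (\<lambda>n. indicator (E n) \<omega>) \<partial>M)"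
  proof (rule nn_integral_mono_AE)
    show "AE \<omega> in M. indicator A \<omega> \<le> liminf (\<lambda>n. indicator (E n) \<omega> :: ennreal)"
      using AE
    proof eventually_elim
      case (elim \<omega>)
      show ?case
      proof (cases "\<omega> \<in> A")
        case True
        with elim have "\<forall>\<^sub>F n in sequentially. \<omega> \<in> E n" by simp
        then have "\<forall>\<^sub>F n in sequentially. (1 :: ennreal) \<le> indicator (E n) \<omega>"
          by eventually_elim simp
        then show ?thesis using True by (simp add: Liminf_bounded)
      qed simp
    qed
  qed
  also have "\<dots> \<le> liminf (\<lambda>n. \<integral>\<^sup>+\<omega>. indicator (E n) \<omega> \<partial>M)"
    using E by (intro nn_integral_liminf) auto
  also have "\<dots> = liminf (\<lambda>n. ennreal (prob (E n)))"
    using E by (simp add: emeasure_eq_measure)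
  also have "\<dots> \<le> liminf (\<lambda>n. ennreal (C n))"
    using le by (intro Liminf_mono) (auto elim!: eventually_mono intro: ennreal_leI)
  also have "\<dots> = ennreal c"
    using C by (intro lim_imp_Liminf tendsto_ennrealI) auto
  finally have "ennreal (prob A) \<le> ennreal c"
    by (simp add: emeasure_eq_measure)
  \<comment> \<open>\<open>ennreal\<close> sends negative numbers to 0, so the comparison returns to
    the reals only once \<open>c\<close> is known to be nonnegative.\<close>
  moreover have "0 \<le> c"
  proof (rule tendsto_lowerbound[OF C])
    show "\<forall>\<^sub>F n in sequentially. 0 \<le> C n"
      using le by eventually_elim (rule order_trans[OF measure_nonneg])
  qed simp
  ultimately show ?thesis by simp
qed

section \<open>Variances of the Riemann sums\<close>

definition exp_weighted_variance :: "real \<Rightarrow> real \<Rightarrow> nat \<Rightarrow> real" where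
  "exp_weighted_variance \<gamma> T n = (\<Sum>i<n. (exp (- \<gamma> * (T - real i * T / real n)) * sqrt (T / real n))\<^sup>2)"

text \<open>The squared weights form a geometric progression with ratio
  \<open>exp (2 * \<gamma> * T / n)\<close>.\<close>

lemma exp_weighted_variance_eq:
  assumes "0 < \<gamma>" "0 < T" "0 < n"
  shows "exp_weighted_variance \<gamma> T n =
    (1 - exp (- 2 * \<gamma> * T)) * ((T / real n) / (exp (2 * \<gamma> * T / real n) - 1))"
proof -
  define q where "q = exp (2 * \<gamma> * T / real n)"
  have "2 * \<gamma> * T / real n \<noteq> 0" using assms by simp
  then have q: "q \<noteq> 1" by (simp add: q_def)
  have "exp_weighted_variance \<gamma> T n = (\<Sum>i<n. exp (- 2 * \<gamma> * T) * (T / real n) * q ^ i)"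
    unfolding exp_weighted_variance_def
  proof (rule sum.cong)
    fix i
    have "(exp (- \<gamma> * (T - real i * T / real n)))\<^sup>2 = exp (- 2 * \<gamma> * T + real i * (2 * \<gamma> * T / real n))"
      unfolding exp_double[symmetric] by (simp add: algebra_simps)
    also have "\<dots> = exp (- 2 * \<gamma> * T) * q ^ i"
      by (simp only: exp_add exp_of_nat_mult q_def)
    finally show "(exp (- \<gamma> * (T - real i * T / real n)) * sqrt (T / real n))\<^sup>2 =
        exp (- 2 * \<gamma> * T) * (T / real n) * q ^ i"
      using assms by (simp add: power_mult_distrib)
  qed simp
  also have "\<dots> = exp (- 2 * \<gamma> * T) * (T / real n) * ((q ^ n - 1) / (q - 1))"
    unfolding sum_distrib_left[symmetric] geometric_sum[OF q] ..
  also have "q ^ n = exp (2 * \<gamma> * T)"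
    using assms unfolding q_def exp_of_nat_mult[symmetric] by simp
  also have "exp (- 2 * \<gamma> * T) * (T / real n) * ((exp (2 * \<gamma> * T) - 1) / (q - 1)) =
      (exp (- 2 * \<gamma> * T) * (exp (2 * \<gamma> * T) - 1)) * ((T / real n) / (q - 1))"
    by simp
  also have "exp (- 2 * \<gamma> * T) * (exp (2 * \<gamma> * T) - 1) = 1 - exp (- 2 * \<gamma> * T)"
    by (simp add: right_diff_distrib flip: exp_add)
  finally show ?thesis unfolding q_def .
qed

text \<open>With \<open>y = 2 * \<gamma> * T / n\<close> the variance is
  \<open>v * (y / (exp y - 1))\<close>, and the last factor lies between \<open>exp (- y)\<close>
  and 1. The upper bound makes the maximal inequality uniform in \<open>n\<close>; both together
  give the limit.\<close>

lemma exp_weighted_variance_bounds: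
  assumes "0 < \<gamma>" "0 < T" "0 < n"
  defines "v \<equiv> (1 - exp (- 2 * \<gamma> * T)) / (2 * \<gamma>)"
  shows "exp_weighted_variance \<gamma> T n \<le> v"
    and "v * exp (- (2 * \<gamma> * T / real n)) \<le> exp_weighted_variance \<gamma> T n"
proof -
  define y where "y = 2 * \<gamma> * T / real n"
  have y: "0 < y" using assms by (simp add: y_def)
  have E: "exp_weighted_variance \<gamma> T n = v * (y / (exp y - 1))"
    using exp_weighted_variance_eq[OF assms(1-3)] assms(1) by (simp add: y_def v_def)
  have v: "0 \<le> v" using assms by (simp add: v_def)
  have 1: "y \<le> exp y - 1" using exp_ge_add_one_self[of y] by linarith
  have "y / (exp y - 1) \<le> 1" using 1 y by simp
  then show "exp_weighted_variance \<gamma> T n \<le> v"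
    unfolding E using v by (metis mult.right_neutral mult_left_mono)
  have "1 - y \<le> exp (- y)" using exp_ge_add_one_self[of "- y"] by linarith
  then have "exp (- y) * (exp y - 1) \<le> y"
    by (simp add: right_diff_distrib flip: exp_add)
  then have "exp (- y) \<le> y / (exp y - 1)"
    using y by (simp add: pos_le_divide_eq)
  then show "v * exp (- (2 * \<gamma> * T / real n)) \<le> exp_weighted_variance \<gamma> T n"
    unfolding E y_def[symmetric] using v by (rule mult_left_mono)
qed

lemma exp_weighted_variance_tendsto:
  assumes "0 < \<gamma>" "0 < T"
  shows "exp_weighted_variance \<gamma> T \<longlonglongrightarrow> (1 - exp (- 2 * \<gamma> * T)) / (2 * \<gamma>)"
proof (rule tendsto_sandwich)
  let ?v = "(1 - exp (- 2 * \<gamma> * T)) / (2 * \<gamma>)"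
  have "(\<lambda>n. ?v * exp (- (2 * \<gamma> * T / real n))) \<longlonglongrightarrow> ?v * exp (- 0)"
    by (intro tendsto_intros lim_const_over_n)
  then show "(\<lambda>n. ?v * exp (- (2 * \<gamma> * T / real n))) \<longlonglongrightarrow> ?v" by simp
  show "\<forall>\<^sub>F n in sequentially. ?v * exp (- (2 * \<gamma> * T / real n)) \<le> exp_weighted_variance \<gamma> T n"
    using eventually_gt_at_top[of 0]
    by eventually_elim (rule exp_weighted_variance_bounds[OF assms])
  show "\<forall>\<^sub>F n in sequentially. exp_weighted_variance \<gamma> T n \<le> ?v"
    using eventually_gt_at_top[of 0]
    by eventually_elim (rule exp_weighted_variance_bounds[OF assms])
qed simp

section \<open>Tail bounds for the Wiener integral\<close>

context standard_brownian_motion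
begin

context
  fixes \<gamma> T :: real
  assumes \<gamma>: "0 < \<gamma>" and T: "0 < T"
begin

text \<open>The integral of \<open>exp (- 2 * \<gamma> * (T - s))\<close> over
  \<open>{0..T}\<close>, the variance of the Wiener integral from 0 to \<open>T\<close>.\<close>

abbreviation "ou_variance \<equiv> (1 - exp (- 2 * \<gamma> * T)) / (2 * \<gamma>)"

lemma ou_variance_pos: "0 < ou_variance"
  using \<gamma> T by simp

lemma weighted_increments_indep:
  "indep_vars (\<lambda>_. borel) (\<lambda>i \<omega>. exp (- \<gamma> * (T - real i * T / real n)) *
     (B (real (Suc i) * T / real n) \<omega> - B (real i * T / real n) \<omega>)) {..<n}"
proof (rule indep_vars_compose2[where M' = "\<lambda>_. borel" and
      Y = "\<lambda>i u. exp (- \<gamma> * (T - real i * T / real n)) * u"])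
  show "indep_vars (\<lambda>_. borel)
      (\<lambda>i \<omega>. B (real (Suc i) * T / real n) \<omega> - B (real i * T / real n) \<omega>) {..<n}"
    using T by (intro independent_increments[of "\<lambda>i. real i * T / real n"])
      (auto simp: mono_on_def intro!: divide_right_mono)
qed simp

lemma weighted_increment_normal:
  assumes "0 < n"
  shows "distributed M lborel (\<lambda>\<omega>. exp (- \<gamma> * (T - real i * T / real n)) *
     (B (real (Suc i) * T / real n) \<omega> - B (real i * T / real n) \<omega>))
     (normal_density 0 (exp (- \<gamma> * (T - real i * T / real n)) * sqrt (T / real n)))"
proof -
  have "real (Suc i) * T / real n - real i * T / real n = T / real n"
    by (simp add: field_simps add_divide_distrib)
  then have "distributed M lborel (\<lambda>\<omega>. B (real (Suc i) * T / real n) \<omega> - B (real i * T / real n) \<omega>)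
      (normal_density 0 (sqrt (T / real n)))"
    using normal_increments[of "real i * T / real n" "real (Suc i) * T / real n"] T assms
    by (simp add: divide_strict_right_mono)
  from normal_density_affine[OF this, of "exp (- \<gamma> * (T - real i * T / real n))" 0]
  show ?thesis using T assms by simp
qed

lemma exp_weighted_sum_measurable [measurable]:
  "(\<lambda>\<omega>. exp_weighted_sum \<gamma> T n (\<lambda>t. B t \<omega>) k) \<in> borel_measurable M"
  unfolding exp_weighted_sum_def using T
  by (intro borel_measurable_sum borel_measurable_times borel_measurable_const
      borel_measurable_diff random_variable_B) auto

lemma exp_weighted_sum_maximal:
  assumes "0 < n" "0 < a"
  shows "prob {\<omega> \<in> space M. \<exists>k\<le>n. a \<le> exp_weighted_sum \<gamma> T n (\<lambda>t. B t \<omega>) k} \<le>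
    exp (- a\<^sup>2 / (2 * ou_variance))"
proof -
  let ?s = "\<lambda>i. exp (- \<gamma> * (T - real i * T / real n)) * sqrt (T / real n)"
  let ?v = ou_variance
  \<comment> \<open>The Chernoff exponent: this \<theta> minimizes
    \<open>- \<theta> * a + \<theta>\<^sup>2 * ?v / 2\<close>.\<close>
  define \<theta> where "\<theta> = a / ?v"
  have s: "0 < ?s i" for i using assms T by simp
  have "emeasure M {\<omega> \<in> space M. \<exists>k\<le>n. a \<le> exp_weighted_sum \<gamma> T n (\<lambda>t. B t \<omega>) k} \<le>
      ennreal (exp (- \<theta> * a) * (\<Prod>i<n. exp (\<theta>\<^sup>2 * (?s i)\<^sup>2 / 2)))"
    unfolding exp_weighted_sum_def
  proof (rule emeasure_tail_sum_le[OF weighted_increments_indep])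
    show "0 \<le> \<theta>" using assms(2) ou_variance_pos unfolding \<theta>_def by (intro divide_nonneg_pos) auto
    show "(\<integral>\<^sup>+\<omega>. ennreal (exp (\<theta> * (exp (- \<gamma> * (T - real i * T / real n)) *
        (B (real (Suc i) * T / real n) \<omega> - B (real i * T / real n) \<omega>)))) \<partial>M) \<le>
        ennreal (exp (\<theta>\<^sup>2 * (?s i)\<^sup>2 / 2))" for i
      by (rule eq_refl) (rule normal_distributed_exp_moment[OF weighted_increment_normal[OF assms(1)] s])
  qed simp
  also have "(\<Prod>i<n. exp (\<theta>\<^sup>2 * (?s i)\<^sup>2 / 2)) = exp (\<theta>\<^sup>2 * exp_weighted_variance \<gamma> T n / 2)"
    by (simp add: exp_weighted_variance_def exp_sum sum_distrib_left sum_divide_distrib)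
  \<comment> \<open>Passing to the limiting variance frees the bound from \<open>n\<close>.\<close>
  also have "exp (- \<theta> * a) * exp (\<theta>\<^sup>2 * exp_weighted_variance \<gamma> T n / 2) \<le> exp (- \<theta> * a) * exp (\<theta>\<^sup>2 * ?v / 2)"
    using exp_weighted_variance_bounds(1)[OF \<gamma> T assms(1)]
    by (intro mult_left_mono iffD2[OF exp_le_cancel_iff] divide_right_mono) auto
  also have "\<dots> = exp (- a\<^sup>2 / (2 * ?v))"
  proof -
    have "- (a / v) * a + (a / v)\<^sup>2 * v / 2 = - a\<^sup>2 / (2 * v)" if "0 < v" for v :: real
      using that by (simp add: field_simps power2_eq_square)
    from this[OF ou_variance_pos] show ?thesis
      unfolding \<theta>_def exp_add[symmetric] by (simp only:)
  qed
  finally show ?thesis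
    by (simp add: emeasure_eq_measure ennreal_leI)
qed

lemma exp_weighted_sum_tail_ge:
  assumes "0 < n" "0 \<le> a"
  shows "exp (- (a + 1)\<^sup>2 / (2 * exp_weighted_variance \<gamma> T n)) / sqrt (2 * pi * exp_weighted_variance \<gamma> T n) \<le>
    prob {\<omega> \<in> space M. a \<le> exp_weighted_sum \<gamma> T n (\<lambda>t. B t \<omega>) 0}"
proof -
  let ?s = "\<lambda>i. exp (- \<gamma> * (T - real i * T / real n)) * sqrt (T / real n)"
  have s: "0 < ?s i" for i using assms T by simp
  have "distributed M lborel (\<lambda>\<omega>. exp_weighted_sum \<gamma> T n (\<lambda>t. B t \<omega>) 0)
      (normal_density (\<Sum>i<n. 0) (sqrt (\<Sum>i<n. (?s i)\<^sup>2)))"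
    unfolding exp_weighted_sum_def atLeast0LessThan
    using assms s
    by (intro sum_indep_normal weighted_increments_indep weighted_increment_normal) auto
  then have "distributed M lborel (\<lambda>\<omega>. exp_weighted_sum \<gamma> T n (\<lambda>t. B t \<omega>) 0)
      (normal_density 0 (sqrt (exp_weighted_variance \<gamma> T n)))"
    by (simp add: exp_weighted_variance_def)
  moreover have "0 < exp_weighted_variance \<gamma> T n"
    unfolding exp_weighted_variance_def using assms s
    by (intro sum_pos zero_less_power) auto
  ultimately show ?thesis
    using normal_tail_ge[of "\<lambda>\<omega>. exp_weighted_sum \<gamma> T n (\<lambda>t. B t \<omega>) 0" "sqrt (exp_weighted_variance \<gamma> T n)" a]
      assms by simp
qed

text \<open>The Riemann sums are only sure to reach levels strictly below \<open>a\<close>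
  eventually, so the bound is proved for each \<open>r < a\<close> and \<open>r\<close> then tends
  to \<open>a\<close> from the left.\<close>

lemma prob_le_of_increment_exceeds:
  assumes A: "A \<in> events" and "0 < a"
    and imp: "AE \<omega> in M. \<omega> \<in> A \<longrightarrow> (\<exists>\<tau>\<in>{0..T}. a \<le> exp_weighted_increment \<gamma> T (\<lambda>t. B t \<omega>) \<tau>)"
  shows "prob A \<le> exp (- a\<^sup>2 / (2 * ou_variance))"
proof -
  have *: "prob A \<le> exp (- r\<^sup>2 / (2 * ou_variance))" if "0 < r" "r < a" for r
  proof (rule prob_le_lim_of_eventually[OF A])
    let ?E = "\<lambda>n. {\<omega> \<in> space M. \<exists>k\<le>n. r \<le> exp_weighted_sum \<gamma> T n (\<lambda>t. B t \<omega>) k}"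
    show "?E n \<in> events" for n
      by measurable
    show "AE \<omega> in M. \<omega> \<in> A \<longrightarrow> (\<forall>\<^sub>F n in sequentially. \<omega> \<in> ?E n)"
      using imp continuous_paths AE_space
    proof eventually_elim
      case (elim \<omega>)
      show ?case
      proof
        assume "\<omega> \<in> A"
        then obtain \<tau> where "\<tau> \<in> {0..T}" "a \<le> exp_weighted_increment \<gamma> T (\<lambda>t. B t \<omega>) \<tau>"
          using elim by blast
        moreover have "continuous_on {0..T} (\<lambda>t. B t \<omega>)"
          by (rule continuous_on_subset) (use elim in auto)
        ultimately have "\<forall>\<^sub>F n in sequentially. \<exists>k\<le>n. r \<le> exp_weighted_sum \<gamma> T n (\<lambda>t. B t \<omega>) k"
          using that by (intro exp_weighted_sum_eventually_exceeds \<gamma> T) auto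
        then show "\<forall>\<^sub>F n in sequentially. \<omega> \<in> ?E n"
          using elim(3) by simp
      qed
    qed
    show "\<forall>\<^sub>F n in sequentially. prob (?E n) \<le> exp (- r\<^sup>2 / (2 * ou_variance))"
      using eventually_gt_at_top[of 0]
      by eventually_elim (rule exp_weighted_sum_maximal[OF _ that(1)])
  qed simp
  have "((\<lambda>r. exp (- r\<^sup>2 / (2 * ou_variance))) \<longlongrightarrow> exp (- a\<^sup>2 / (2 * ou_variance))) (at_left a)"
    using ou_variance_pos by (intro tendsto_intros) auto
  then show ?thesis
  proof (rule tendsto_lowerbound)
    show "\<forall>\<^sub>F r in at_left a. prob A \<le> exp (- r\<^sup>2 / (2 * ou_variance))"
      unfolding eventually_at_left_field using * \<open>0 < a\<close> by blast
  qed simp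
qed

text \<open>Passing to complements lets the same Fatou argument produce a lower bound: if the limit
  is strictly below \<open>a\<close>, so are the sums eventually.\<close>

lemma prob_ge_of_increment_exceeds:
  assumes A: "A \<in> events" and "0 \<le> a"
    and imp: "AE \<omega> in M. a \<le> exp_weighted_increment \<gamma> T (\<lambda>t. B t \<omega>) 0 \<longrightarrow> \<omega> \<in> A"
  shows "exp (- (a + 1)\<^sup>2 / (2 * ou_variance)) / sqrt (2 * pi * ou_variance) \<le> prob A"
proof -
  let ?E = "\<lambda>n. {\<omega> \<in> space M. a \<le> exp_weighted_sum \<gamma> T n (\<lambda>t. B t \<omega>) 0}"
  let ?l = "\<lambda>v. exp (- (a + 1)\<^sup>2 / (2 * v)) / sqrt (2 * pi * v)"
  have E: "?E n \<in> events" for n by measurable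
  have "prob (space M - A) \<le> 1 - ?l ou_variance"
  proof (rule prob_le_lim_of_eventually)
    show "space M - A \<in> events" using A by auto
    show "space M - ?E n \<in> events" for n using E by auto
    show "AE \<omega> in M. \<omega> \<in> space M - A \<longrightarrow> (\<forall>\<^sub>F n in sequentially. \<omega> \<in> space M - ?E n)"
      using imp continuous_paths AE_space
    proof eventually_elim
      case (elim \<omega>)
      show ?case
      proof
        assume "\<omega> \<in> space M - A"
        then have "exp_weighted_increment \<gamma> T (\<lambda>t. B t \<omega>) 0 < a"
          using elim by force
        moreover have "continuous_on {0..T} (\<lambda>t. B t \<omega>)"
          by (rule continuous_on_subset) (use elim in auto)
        ultimately have "\<forall>\<^sub>F n in sequentially. exp_weighted_sum \<gamma> T n (\<lambda>t. B t \<omega>) 0 < a"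
          using exp_weighted_sum_tendsto[OF _ \<gamma> T] by (intro order_tendstoD)
        then show "\<forall>\<^sub>F n in sequentially. \<omega> \<in> space M - ?E n"
          by (rule eventually_mono) (use elim(3) in auto)
      qed
    qed
    show "\<forall>\<^sub>F n in sequentially. prob (space M - ?E n) \<le> 1 - ?l (exp_weighted_variance \<gamma> T n)"
      using eventually_gt_at_top[of 0]
    proof eventually_elim
      case (elim n)
      show ?case
        using exp_weighted_sum_tail_ge[OF elim \<open>0 \<le> a\<close>] unfolding prob_compl[OF E] by simp
    qed
    show "(\<lambda>n. 1 - ?l (exp_weighted_variance \<gamma> T n)) \<longlonglongrightarrow> 1 - ?l ou_variance"
      using ou_variance_pos
      by (intro tendsto_intros exp_weighted_variance_tendsto \<gamma> T) auto
  qed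
  then show ?thesis unfolding prob_compl[OF A] by simp
qed

end
end

section \<open>Logarithmic asymptotics of the reflected process\<close>

context
  fixes \<alpha> \<gamma> \<sigma> T x b :: real
    and M :: "'a measure" and B :: "real \<Rightarrow> 'a \<Rightarrow> real" and Y L :: "real \<Rightarrow> real \<Rightarrow> 'a \<Rightarrow> real"
  assumes \<alpha>: "0 < \<alpha>" and \<gamma>: "0 < \<gamma>" and \<sigma>: "0 < \<sigma>" and T: "0 < T" and x: "0 \<le> x"
    and BM: "standard_brownian_motion M B"
    and Y: "\<And>\<epsilon>. 0 < \<epsilon> \<Longrightarrow> reflected_ou_process M B \<alpha> \<gamma> (sqrt \<epsilon> * \<sigma>) x (Y \<epsilon>) (L \<epsilon>)"
    and b: "ou_mean \<alpha> \<gamma> x T < b"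
begin

interpretation standard_brownian_motion M B by (rule BM)

text \<open>The level to be reached by the Wiener integral of \<open>B\<close> itself, after
  division by the noise intensity; it tends to infinity as \<epsilon> tends to 0.\<close>

abbreviation "ou_level \<epsilon> \<equiv> (b - ou_mean \<alpha> \<gamma> x T) / (sqrt \<epsilon> * \<sigma>)"

lemma reflected_ou_event_measurable:
  assumes "0 < \<epsilon>"
  shows "{\<omega> \<in> space M. b \<le> Y \<epsilon> T \<omega>} \<in> events"
proof -
  have "Y \<epsilon> T \<in> borel_measurable M"
    using Y[OF assms] T by (simp add: reflected_ou_process_def)
  then show ?thesis by measurable
qed

lemma reflected_ou_AE:
  assumes "0 < \<epsilon>"
  shows "AE \<omega> in M. \<omega> \<in> space M \<and> continuous_on {0..} (\<lambda>t. sqrt \<epsilon> * \<sigma> * B t \<omega>) \<and> sqrt \<epsilon> * \<sigma> * B 0 \<omega> = 0 \<and>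
    reflected_ou_path \<alpha> \<gamma> x (\<lambda>t. sqrt \<epsilon> * \<sigma> * B t \<omega>) (\<lambda>t. Y \<epsilon> t \<omega>) (\<lambda>t. L \<epsilon> t \<omega>)"
proof -
  have "AE \<omega> in M. reflected_ou_path \<alpha> \<gamma> x (\<lambda>t. sqrt \<epsilon> * \<sigma> * B t \<omega>) (\<lambda>t. Y \<epsilon> t \<omega>) (\<lambda>t. L \<epsilon> t \<omega>)"
    using Y[OF assms] by (simp add: reflected_ou_process_def)
  with AE_space B_zero continuous_paths show ?thesis
    by eventually_elim (auto intro!: continuous_intros)
qed

lemma reflected_ou_tail_upper:
  assumes "0 < \<epsilon>"
  shows "prob {\<omega> \<in> space M. b \<le> Y \<epsilon> T \<omega>} \<le>
    exp (- (ou_level \<epsilon>)\<^sup>2 / (2 * ((1 - exp (- 2 * \<gamma> * T)) / (2 * \<gamma>))))"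
proof (rule prob_le_of_increment_exceeds[OF \<gamma> T reflected_ou_event_measurable[OF assms]])
  have \<eta>: "0 < sqrt \<epsilon> * \<sigma>" using assms \<sigma> by simp
  show "0 < ou_level \<epsilon>" using b \<eta> by simp
  \<comment> \<open>The pathwise upper bound requires a positive end value of the path.\<close>
  have bpos: "0 < b" using ou_mean_nonneg[OF \<alpha> \<gamma> x, of T] T b by simp
  show "AE \<omega> in M. \<omega> \<in> {\<omega> \<in> space M. b \<le> Y \<epsilon> T \<omega>} \<longrightarrow>
      (\<exists>\<tau>\<in>{0..T}. ou_level \<epsilon> \<le> exp_weighted_increment \<gamma> T (\<lambda>t. B t \<omega>) \<tau>)"
    using reflected_ou_AE[OF assms]
  proof eventually_elim
    case (elim \<omega>)
    show ?case
    proof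
      assume "\<omega> \<in> {\<omega> \<in> space M. b \<le> Y \<epsilon> T \<omega>}"
      then have YT: "b \<le> Y \<epsilon> T \<omega>" by simp
      then have "0 < Y \<epsilon> T \<omega>" using bpos by linarith
      then obtain \<tau> where \<tau>: "\<tau> \<in> {0..T}" "Y \<epsilon> T \<omega> \<le> ou_mean \<alpha> \<gamma> x T +
          exp_weighted_increment \<gamma> T (\<lambda>t. sqrt \<epsilon> * \<sigma> * B t \<omega>) \<tau>"
        using elim \<alpha> \<gamma> T x
        by (elim conjE reflected_ou_path_upper_bound[where w = "\<lambda>t. sqrt \<epsilon> * \<sigma> * B t \<omega>" and y = "\<lambda>t. Y \<epsilon> t \<omega>"]) auto
      then have "b - ou_mean \<alpha> \<gamma> x T \<le> exp_weighted_increment \<gamma> T (\<lambda>t. B t \<omega>) \<tau> * (sqrt \<epsilon> * \<sigma>)"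
        using YT unfolding exp_weighted_increment_cmult by (simp add: mult.commute)
      then have "ou_level \<epsilon> \<le> exp_weighted_increment \<gamma> T (\<lambda>t. B t \<omega>) \<tau>"
        by (subst pos_divide_le_eq[OF \<eta>])
      with \<tau>(1) show "\<exists>\<tau>\<in>{0..T}. ou_level \<epsilon> \<le> exp_weighted_increment \<gamma> T (\<lambda>t. B t \<omega>) \<tau>" by blast
    qed
  qed
qed

lemma reflected_ou_tail_lower:
  assumes "0 < \<epsilon>"
  shows "exp (- (ou_level \<epsilon> + 1)\<^sup>2 / (2 * ((1 - exp (- 2 * \<gamma> * T)) / (2 * \<gamma>)))) /
      sqrt (2 * pi * ((1 - exp (- 2 * \<gamma> * T)) / (2 * \<gamma>))) \<le>
    prob {\<omega> \<in> space M. b \<le> Y \<epsilon> T \<omega>}"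
proof (rule prob_ge_of_increment_exceeds[OF \<gamma> T reflected_ou_event_measurable[OF assms]])
  have \<eta>: "0 < sqrt \<epsilon> * \<sigma>" using assms \<sigma> by simp
  then show "0 \<le> ou_level \<epsilon>" using b by (intro divide_nonneg_pos) auto
  show "AE \<omega> in M. ou_level \<epsilon> \<le> exp_weighted_increment \<gamma> T (\<lambda>t. B t \<omega>) 0 \<longrightarrow>
      \<omega> \<in> {\<omega> \<in> space M. b \<le> Y \<epsilon> T \<omega>}"
    using reflected_ou_AE[OF assms]
  proof eventually_elim
    case (elim \<omega>)
    show ?case
    proof
      assume "ou_level \<epsilon> \<le> exp_weighted_increment \<gamma> T (\<lambda>t. B t \<omega>) 0"
      then have "b - ou_mean \<alpha> \<gamma> x T \<le> exp_weighted_increment \<gamma> T (\<lambda>t. sqrt \<epsilon> * \<sigma> * B t \<omega>) 0"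
        unfolding exp_weighted_increment_cmult by (subst (asm) pos_divide_le_eq[OF \<eta>]) (simp add: mult.commute)
      moreover have "ou_mean \<alpha> \<gamma> x T + exp_weighted_increment \<gamma> T (\<lambda>t. sqrt \<epsilon> * \<sigma> * B t \<omega>) 0 \<le> Y \<epsilon> T \<omega>"
        using elim \<gamma> T
        by (intro ou_pushed_path_lower_bound[where y = "\<lambda>t. Y \<epsilon> t \<omega>" and l = "\<lambda>t. L \<epsilon> t \<omega>"])
           (auto simp: reflected_ou_path_def)
      ultimately show "\<omega> \<in> {\<omega> \<in> space M. b \<le> Y \<epsilon> T \<omega>}" using elim by simp
    qed
  qed
qed

text \<open>With the level \<open>c / sqrt \<epsilon>\<close> the upper bound gives the limit
  already for each \<epsilon>. In the lower bound the shift of the level by 1 and the Gaussian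
  prefactor disappear as \<epsilon> tends to 0.\<close>

lemma reflected_ou_log_tail_limit:
  "((\<lambda>\<epsilon>. \<epsilon> * ln (prob {\<omega> \<in> space M. b \<le> Y \<epsilon> T \<omega>})) \<longlongrightarrow>
     - ((b - ou_mean \<alpha> \<gamma> x T)\<^sup>2 / ((1 - exp (- 2 * \<gamma> * T)) * (\<sigma>\<^sup>2 / \<gamma>)))) (at_right 0)"
proof -
  define v where "v = (1 - exp (- 2 * \<gamma> * T)) / (2 * \<gamma>)"
  define c where "c = (b - ou_mean \<alpha> \<gamma> x T) / \<sigma>"
  have v: "0 < v" using \<gamma> T by (simp add: v_def)
  have level: "ou_level \<epsilon> = c / sqrt \<epsilon>" for \<epsilon> by (simp add: c_def)
  have rate: "(b - ou_mean \<alpha> \<gamma> x T)\<^sup>2 / ((1 - exp (- 2 * \<gamma> * T)) * (\<sigma>\<^sup>2 / \<gamma>)) = c\<^sup>2 / (2 * v)"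
  proof -
    have "2 * (u / (2 * \<gamma>)) = u / \<gamma>" for u by simp
    then have "2 * v = (1 - exp (- 2 * \<gamma> * T)) / \<gamma>" unfolding v_def .
    then show ?thesis by (simp add: c_def power_divide mult_ac)
  qed
  let ?p = "\<lambda>\<epsilon>. prob {\<omega> \<in> space M. b \<le> Y \<epsilon> T \<omega>}"
  have lower: "- (c + sqrt \<epsilon>)\<^sup>2 / (2 * v) - \<epsilon> * ln (sqrt (2 * pi * v)) \<le> \<epsilon> * ln (?p \<epsilon>)"
    and upper: "\<epsilon> * ln (?p \<epsilon>) \<le> - (c\<^sup>2 / (2 * v))" if "0 < \<epsilon>" for \<epsilon>
  proof -
    have s: "0 < sqrt (2 * pi * v)" using v by simp
    have low: "exp (- (c / sqrt \<epsilon> + 1)\<^sup>2 / (2 * v)) / sqrt (2 * pi * v) \<le> ?p \<epsilon>"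
      using reflected_ou_tail_lower[OF that] unfolding level v_def[symmetric] .
    \<comment> \<open>The lower bound makes the probability positive, as the monotonicity of
      \<open>ln\<close> demands.\<close>
    then have p: "0 < ?p \<epsilon>"
      using s by (meson divide_pos_pos exp_gt_zero less_le_trans)
    have "- (c / sqrt \<epsilon> + 1)\<^sup>2 / (2 * v) - ln (sqrt (2 * pi * v)) =
        ln (exp (- (c / sqrt \<epsilon> + 1)\<^sup>2 / (2 * v)) / sqrt (2 * pi * v))"
      using s by (subst ln_div) auto
    also have "\<dots> \<le> ln (?p \<epsilon>)"
      using low s by (intro ln_mono divide_pos_pos) auto
    finally have "\<epsilon> * (- (c / sqrt \<epsilon> + 1)\<^sup>2 / (2 * v) - ln (sqrt (2 * pi * v))) \<le> \<epsilon> * ln (?p \<epsilon>)"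
      using that by (intro mult_left_mono) auto
    \<comment> \<open>Scaling by \<epsilon> turns the shift by 1 into a shift by
      \<open>sqrt \<epsilon>\<close>.\<close>
    moreover have "\<epsilon> * (c / sqrt \<epsilon> + 1)\<^sup>2 = (c + sqrt \<epsilon>)\<^sup>2"
    proof -
      have "\<epsilon> * (c / sqrt \<epsilon> + 1)\<^sup>2 = (sqrt \<epsilon> * (c / sqrt \<epsilon> + 1))\<^sup>2"
        using that by (simp add: power_mult_distrib)
      also have "sqrt \<epsilon> * (c / sqrt \<epsilon> + 1) = c + sqrt \<epsilon>"
        using that by (simp add: distrib_left)
      finally show ?thesis .
    qed
    ultimately show "- (c + sqrt \<epsilon>)\<^sup>2 / (2 * v) - \<epsilon> * ln (sqrt (2 * pi * v)) \<le> \<epsilon> * ln (?p \<epsilon>)"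
      by (simp add: right_diff_distrib)
    have "?p \<epsilon> \<le> exp (- (c / sqrt \<epsilon>)\<^sup>2 / (2 * v))"
      using reflected_ou_tail_upper[OF that] unfolding level v_def[symmetric] .
    then have "ln (?p \<epsilon>) \<le> ln (exp (- (c / sqrt \<epsilon>)\<^sup>2 / (2 * v)))"
      using p by (rule ln_mono)
    then have "\<epsilon> * ln (?p \<epsilon>) \<le> \<epsilon> * (- (c / sqrt \<epsilon>)\<^sup>2 / (2 * v))"
      unfolding ln_exp using that by (intro mult_left_mono) auto
    also have "\<dots> = - (c\<^sup>2 / (2 * v))"
      using that by (simp add: power_divide)
    finally show "\<epsilon> * ln (?p \<epsilon>) \<le> - (c\<^sup>2 / (2 * v))" .
  qed
  have "((\<lambda>\<epsilon>. \<epsilon> * ln (?p \<epsilon>)) \<longlongrightarrow> - (c\<^sup>2 / (2 * v))) (at_right 0)"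
  proof (rule tendsto_sandwich)
    show "\<forall>\<^sub>F \<epsilon> in at_right 0. - (c + sqrt \<epsilon>)\<^sup>2 / (2 * v) - \<epsilon> * ln (sqrt (2 * pi * v)) \<le> \<epsilon> * ln (?p \<epsilon>)"
      using eventually_at_right_less by eventually_elim (rule lower)
    show "\<forall>\<^sub>F \<epsilon> in at_right 0. \<epsilon> * ln (?p \<epsilon>) \<le> - (c\<^sup>2 / (2 * v))"
      using eventually_at_right_less by eventually_elim (rule upper)
    have "((\<lambda>\<epsilon>. - (c + sqrt \<epsilon>)\<^sup>2 / (2 * v) - \<epsilon> * ln (sqrt (2 * pi * v))) \<longlongrightarrow>
        - (c + sqrt 0)\<^sup>2 / (2 * v) - 0 * ln (sqrt (2 * pi * v))) (at_right 0)"
      using v by (intro tendsto_intros) auto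
    then show "((\<lambda>\<epsilon>. - (c + sqrt \<epsilon>)\<^sup>2 / (2 * v) - \<epsilon> * ln (sqrt (2 * pi * v))) \<longlongrightarrow> - (c\<^sup>2 / (2 * v))) (at_right 0)"
      by simp
  qed simp
  then show ?thesis unfolding rate .
qed

end

theorem theorem3p3:
  fixes \<alpha> \<gamma> \<sigma> T x b :: real
    and M :: "'a measure" and B :: "real \<Rightarrow> 'a \<Rightarrow> real"
    and Y L :: "real \<Rightarrow> real \<Rightarrow> 'a \<Rightarrow> real"
  assumes "\<alpha> > 0" and "\<gamma> > 0" and "\<sigma> > 0" and "T > 0" and "x \<ge> 0"
    and "standard_brownian_motion M B"
    and "\<And>\<epsilon>. \<epsilon> > 0 \<Longrightarrow> reflected_ou_process M B \<alpha> \<gamma> (sqrt \<epsilon> * \<sigma>) x (Y \<epsilon>) (L \<epsilon>)"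
    and "b > ou_mean \<alpha> \<gamma> x T"
  shows "((\<lambda>\<epsilon>. \<epsilon> * ln (measure M {\<omega> \<in> space M. Y \<epsilon> T \<omega> \<ge> b})) \<longlongrightarrow>
           - ((b - (\<alpha> / \<gamma> + (x - \<alpha> / \<gamma>) * exp (- \<gamma> * T)))\<^sup>2 /
              ((1 - exp (- 2 * \<gamma> * T)) * (\<sigma>\<^sup>2 / \<gamma>)))) (at_right 0)
         \<and> minimizers (I_plus \<alpha> \<gamma> \<sigma> T x) (S_plus T x b) =
             {restrict (f_star \<alpha> \<gamma> T x b) {0..T}}"
  using reflected_ou_log_tail_limit[OF assms] minimizers_I_plus[OF assms(1-5,8)]
  unfolding ou_mean_def by blast

end
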